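(* The Helly number $h(G)$ of a Peano partial cube $G$ is at most $3$, with equality if and only if $G$ is not a median graph.
   Context: Graphs are simple, undirected, possibly infinite. In a connected graph $G$, $I_G(x,y)$ is the set of vertices on shortest $(x,y)$-paths; $A\subseteq V(G)$ is convex (geodesic convexity) if $I_G(x,y)\subseteq A$ for all $x,y\in A$; $co_G$ is the convex hull and $\mathcal{I}_G(A)=\bigcup_{x,y\in A}I_G(x,y)$. A partial cube is an isometric subgraph of a (possibly infinite) hypercube. A copoint at $x$ is a convex set maximal with respect to not containing $x$; $ph(G)$ is the least $n$ with $co_G(C\cup\{x\})=\mathcal{I}^n_G(C\cup\{x\})$ for all $x$ and copoints $C$ at $x$. A Peano partial cube is a partial cube all of whose finite convex subgraphs have pre-hull number at most $1$. A median graph is a connected graph in which every triple $u,v,w$ of vertices has exactly one vertex in $I(u,v)\cap I(v,w)\cap I(w,u)$. The Helly number $h(G)$ is the smallest integer $h$, if it exists, such that every finite family of convex sets of $G$ which are $h$-wise non-disjoint (every $h$ of them have a common point) has a non-empty intersection. *)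

theory Defs
  imports Main
begin

definition simple_graph :: "'a set \<Rightarrow> ('a \<Rightarrow> 'a \<Rightarrow> bool) \<Rightarrow> bool" where
  "simple_graph V E \<longleftrightarrow> (\<forall>x y. E x y \<longrightarrow> x \<in> V \<and> y \<in> V \<and> x \<noteq> y \<and> E y x)"

fun walk :: "'a set \<Rightarrow> ('a \<Rightarrow> 'a \<Rightarrow> bool) \<Rightarrow> 'a list \<Rightarrow> bool" where
  "walk V E [] = False"
| "walk V E [x] = (x \<in> V)"
| "walk V E (x # y # p) = (x \<in> V \<and> E x y \<and> walk V E (y # p))"

definition walk_betw :: "'a set \<Rightarrow> ('a \<Rightarrow> 'a \<Rightarrow> bool) \<Rightarrow> 'a \<Rightarrow> 'a \<Rightarrow> 'a list \<Rightarrow> bool" where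
  "walk_betw V E x y p \<longleftrightarrow> walk V E p \<and> hd p = x \<and> last p = y"

definition connected_graph :: "'a set \<Rightarrow> ('a \<Rightarrow> 'a \<Rightarrow> bool) \<Rightarrow> bool" where
  "connected_graph V E \<longleftrightarrow> simple_graph V E \<and> (\<forall>x\<in>V. \<forall>y\<in>V. \<exists>p. walk_betw V E x y p)"

definition gdist :: "'a set \<Rightarrow> ('a \<Rightarrow> 'a \<Rightarrow> bool) \<Rightarrow> 'a \<Rightarrow> 'a \<Rightarrow> nat" where
  "gdist V E x y = (LEAST n. \<exists>p. walk_betw V E x y p \<and> length p = Suc n)"

definition interval :: "'a set \<Rightarrow> ('a \<Rightarrow> 'a \<Rightarrow> bool) \<Rightarrow> 'a \<Rightarrow> 'a \<Rightarrow> 'a set" where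
  "interval V E x y =
     {z. \<exists>p. walk_betw V E x y p \<and> length p = Suc (gdist V E x y) \<and> z \<in> set p}"

definition gconvex :: "'a set \<Rightarrow> ('a \<Rightarrow> 'a \<Rightarrow> bool) \<Rightarrow> 'a set \<Rightarrow> bool" where
  "gconvex V E A \<longleftrightarrow> A \<subseteq> V \<and> (\<forall>x\<in>A. \<forall>y\<in>A. interval V E x y \<subseteq> A)"

definition convex_hull_g :: "'a set \<Rightarrow> ('a \<Rightarrow> 'a \<Rightarrow> bool) \<Rightarrow> 'a set \<Rightarrow> 'a set" where
  "convex_hull_g V E A = \<Inter> {C. gconvex V E C \<and> A \<subseteq> C}"

definition interval_op :: "'a set \<Rightarrow> ('a \<Rightarrow> 'a \<Rightarrow> bool) \<Rightarrow> 'a set \<Rightarrow> 'a set" where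
  "interval_op V E A = (\<Union>x\<in>A. \<Union>y\<in>A. interval V E x y)"

definition interval_iter :: "'a set \<Rightarrow> ('a \<Rightarrow> 'a \<Rightarrow> bool) \<Rightarrow> nat \<Rightarrow> 'a set \<Rightarrow> 'a set" where
  "interval_iter V E n A = (interval_op V E ^^ n) A"

definition copoint :: "'a set \<Rightarrow> ('a \<Rightarrow> 'a \<Rightarrow> bool) \<Rightarrow> 'a \<Rightarrow> 'a set \<Rightarrow> bool" where
  "copoint V E x C \<longleftrightarrow> x \<in> V \<and> gconvex V E C \<and> x \<notin> C \<and>
     (\<forall>D. gconvex V E D \<and> x \<notin> D \<and> C \<subseteq> D \<longrightarrow> D = C)"

definition prehull_prop :: "'a set \<Rightarrow> ('a \<Rightarrow> 'a \<Rightarrow> bool) \<Rightarrow> nat \<Rightarrow> bool" where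
  "prehull_prop V E n \<longleftrightarrow> (\<forall>x C. copoint V E x C \<longrightarrow>
      convex_hull_g V E (insert x C) = interval_iter V E n (insert x C))"

definition prehull_number_le :: "'a set \<Rightarrow> ('a \<Rightarrow> 'a \<Rightarrow> bool) \<Rightarrow> nat \<Rightarrow> bool" where
  "prehull_number_le V E n \<longleftrightarrow> (\<exists>m\<le>n. prehull_prop V E m)"

text \<open>Partial cube: connected graph isometrically embeddable into a hypercube
  Q(X), whose vertices are the finite subsets of X, adjacent iff their symmetric
  difference is a singleton (so hypercube distance = card of symmetric difference).
  The coordinate set X is taken inside the type 'a \<times> 'a, which is large enough.\<close>

definition partial_cube :: "'a set \<Rightarrow> ('a \<Rightarrow> 'a \<Rightarrow> bool) \<Rightarrow> bool" where
  "partial_cube V E \<longleftrightarrow> connected_graph V E \<and>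
     (\<exists>f :: 'a \<Rightarrow> ('a \<times> 'a) set. (\<forall>v\<in>V. finite (f v)) \<and>
        (\<forall>u\<in>V. \<forall>v\<in>V. gdist V E u v = card ((f u - f v) \<union> (f v - f u))))"

definition induced_adj :: "('a \<Rightarrow> 'a \<Rightarrow> bool) \<Rightarrow> 'a set \<Rightarrow> 'a \<Rightarrow> 'a \<Rightarrow> bool" where
  "induced_adj E W x y \<longleftrightarrow> E x y \<and> x \<in> W \<and> y \<in> W"

definition peano_partial_cube :: "'a set \<Rightarrow> ('a \<Rightarrow> 'a \<Rightarrow> bool) \<Rightarrow> bool" where
  "peano_partial_cube V E \<longleftrightarrow> partial_cube V E \<and>
     (\<forall>W. finite W \<and> gconvex V E W \<longrightarrow> prehull_number_le W (induced_adj E W) 1)"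

definition median_graph :: "'a set \<Rightarrow> ('a \<Rightarrow> 'a \<Rightarrow> bool) \<Rightarrow> bool" where
  "median_graph V E \<longleftrightarrow> connected_graph V E \<and>
     (\<forall>u\<in>V. \<forall>v\<in>V. \<forall>w\<in>V. \<exists>!m. m \<in> interval V E u v \<inter> interval V E v w \<inter> interval V E w u)"

definition helly_prop :: "'a set \<Rightarrow> ('a \<Rightarrow> 'a \<Rightarrow> bool) \<Rightarrow> nat \<Rightarrow> bool" where
  "helly_prop V E h \<longleftrightarrow> (\<forall>F. finite F \<and> (\<forall>A\<in>F. gconvex V E A) \<and>
      (\<forall>S\<subseteq>F. card S \<le> h \<longrightarrow> \<Inter>S \<noteq> {}) \<longrightarrow> \<Inter>F \<noteq> {})"

definition helly_number :: "'a set \<Rightarrow> ('a \<Rightarrow> 'a \<Rightarrow> bool) \<Rightarrow> nat" where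
  "helly_number V E = (LEAST h. helly_prop V E h)"

end

theory Submission
  imports Defs
begin

text \<open>A failure of the Helly property for four convex sets yields, in a finite convex set \<open>W\<close> of
  minimal size, four halfspaces \<open>A, B, C, D\<close> with empty intersection any three of which meet.
  Minimality of \<open>W\<close> forbids nontrivial halfspaces strictly inside or outside \<open>A, B, C, D\<close>, so by
  the pre-hull condition every geodesic of \<open>W\<close> extends across all four of them: they
  behave like four pseudolines in general position. The pre-hull condition inside \<open>A\<close> then produces
  a further pseudoline through the crossing point of \<open>A\<close> and \<open>B\<close>, and a
  Sylvester--Gallai descent to ever smaller triangles \<open>A \<inter> C - B\<close> is contradictory.
  That the Helly number is at most 2 exactly for median graphs follows from the convexity of
  intervals and the uniqueness of medians in hypercubes.\<close>

section \<open>Four halfspaces in general position\<close>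

text \<open>The picture behind the pseudolines is a sphere: halfspaces act as hemispheres, their
  boundaries as great circles, and \<open>antipodal\<close> supplies opposite points. Four great
  circles in general position realise all but two opposite ones of the sixteen sign cells; here
  these two are the common intersection, empty by assumption, and the common exterior, empty by
  \<open>Quad_cover\<close>. The descent resembles Kelly's proof of the Sylvester-Gallai theorem:
  the pre-hull condition puts a third pseudoline through the crossing point of any two of the four,
  so no crossing point is ordinary, and the size of \<open>A \<inter> C - B\<close> replaces the
  distance from a point to a line. The pre-hull hypothesis speaks of finite convex subgraphs only,
  while \<open>V\<close> and the given convex sets may be infinite. Therefore \<open>quad\<close>
  carries an ambient set \<open>Z\<close>: the four sets stay fixed while the ambient set shrinks,
  which is how minimality is tested.\<close>

definition quad :: "'a set \<Rightarrow> 'a set \<Rightarrow> 'a set \<Rightarrow> 'a set \<Rightarrow> 'a set \<Rightarrow> bool" where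
  "quad Z A B C D \<longleftrightarrow> Z \<inter> A \<inter> B \<inter> C \<inter> D = {} \<and> Z \<inter> A \<inter> B \<inter> C \<noteq> {} \<and> Z \<inter> A \<inter> B \<inter> D \<noteq> {}
     \<and> Z \<inter> A \<inter> C \<inter> D \<noteq> {} \<and> Z \<inter> B \<inter> C \<inter> D \<noteq> {}"

lemma quad_rotate: "quad Z A B C D \<Longrightarrow> quad Z B C D A"
  unfolding quad_def by (simp add: Int_ac conj_ac)

text \<open>This is what membership of \<open>y\<close> in the interval between \<open>x\<close> and
  \<open>z\<close> becomes when only halfspaces are visible; it frees the combinatorial part from
  walks and distances.\<close>

definition btw :: "'a set set \<Rightarrow> 'a \<Rightarrow> 'a \<Rightarrow> 'a \<Rightarrow> bool" where
  "btw HS x y z \<longleftrightarrow> (\<forall>L\<in>HS. x \<in> L \<and> z \<in> L \<longrightarrow> y \<in> L)"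

text \<open>The assumption \<open>prehull\<close> is what pre-hull number at most 1 says about a copoint at \<^term>\<open>x\<close> of
  the convex subgraph \<^term>\<open>Q\<close> that contains \<^term>\<open>P \<inter> Q\<close>, phrased with a halfspace \<^term>\<open>H\<close>
  of \<^term>\<open>W\<close> in place of the copoint.\<close>

locale halfspaces =
  fixes W :: "'a set" and HS :: "'a set set"
  assumes finW: "finite W"
    and subW: "H \<in> HS \<Longrightarrow> H \<subseteq> W"
    and W_in: "W \<in> HS"
    and compl: "H \<in> HS \<Longrightarrow> W - H \<in> HS"
    and edge: "\<lbrakk>H \<in> HS; x \<in> W - H; y \<in> H\<rbrakk> \<Longrightarrow> \<exists>s\<in>W - H. \<exists>t\<in>H. btw HS x s y \<and> btw HS x t y
       \<and> (\<forall>L\<in>HS. L \<noteq> H \<and> L \<noteq> W - H \<longrightarrow> (s \<in> L \<longleftrightarrow> t \<in> L))"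
    and prehull: "\<lbrakk>Q \<in> HS; P \<in> HS; P \<inter> Q \<noteq> {}; x \<in> Q - P\<rbrakk> \<Longrightarrow>
       \<exists>H\<in>HS. P \<inter> Q \<subseteq> H \<and> x \<notin> H \<and>
         (\<forall>y\<in>Q. (\<exists>L\<in>HS. P \<inter> Q \<subseteq> L \<and> x \<in> L \<and> y \<notin> L) \<or> (\<exists>k\<in>Q \<inter> H. btw HS x y k))"

text \<open>The minimal choice of \<open>W\<close> enters only through its proper halfspaces
  \<open>Z\<close>, which are smaller convex sets.\<close>

locale min_halfspaces = halfspaces +
  assumes minimal: "\<lbrakk>Z \<in> HS; Z \<noteq> W; A \<in> HS; B \<in> HS; C \<in> HS; D \<in> HS\<rbrakk> \<Longrightarrow> \<not> quad Z A B C D"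
begin

section \<open>Betweenness and quadruples of halfspaces\<close>

lemma btw_in: "\<lbrakk>btw HS x y k; L \<in> HS; x \<in> L; k \<in> L\<rbrakk> \<Longrightarrow> y \<in> L"
  unfolding btw_def by blast

lemma btw_out: "\<lbrakk>btw HS x y k; L \<in> HS; x \<in> W - L; k \<in> W - L\<rbrakk> \<Longrightarrow> y \<notin> L"
  using btw_in[of x y k "W - L"] compl by blast

lemma edgeE:
  assumes "H \<in> HS" "x \<in> W" "x \<notin> H" "y \<in> H"
  obtains s t where "s \<in> W" "s \<notin> H" "t \<in> W" "t \<in> H" "\<And>L. \<lbrakk>L \<in> HS; x \<in> L; y \<in> L\<rbrakk> \<Longrightarrow> s \<in> L \<and> t \<in> L"
    "\<And>L. \<lbrakk>L \<in> HS; L \<noteq> H; L \<noteq> W - H\<rbrakk> \<Longrightarrow> s \<in> L \<longleftrightarrow> t \<in> L"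
proof -
  obtain s t where st: "s \<in> W - H" "t \<in> H" "btw HS x s y" "btw HS x t y"
     "\<forall>L\<in>HS. L \<noteq> H \<and> L \<noteq> W - H \<longrightarrow> (s \<in> L \<longleftrightarrow> t \<in> L)"
    using edge[of H x y] assms by blast
  have W: "s \<in> W" "t \<in> W" using st(1,2) subW[OF assms(1)] by auto
  show thesis
  proof (rule that[of s t])
    show "s \<in> W" "s \<notin> H" "t \<in> W" "t \<in> H" using st(1,2) W by auto
  next
    fix L assume "L \<in> HS" "x \<in> L" "y \<in> L"
    then show "s \<in> L \<and> t \<in> L" using btw_in[OF st(3)] btw_in[OF st(4)] by simp
  next
    fix L assume "L \<in> HS" "L \<noteq> H" "L \<noteq> W - H"
    then show "s \<in> L \<longleftrightarrow> t \<in> L" using st(5) by simp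
  qed
qed

definition Quad :: "'a set \<Rightarrow> 'a set \<Rightarrow> 'a set \<Rightarrow> 'a set \<Rightarrow> bool" where
  "Quad A B C D \<longleftrightarrow> A \<in> HS \<and> B \<in> HS \<and> C \<in> HS \<and> D \<in> HS \<and> quad W A B C D"

lemma QuadI:
  assumes "A \<in> HS" "B \<in> HS" "C \<in> HS" "D \<in> HS" "A \<inter> B \<inter> C \<inter> D = {}"
    "A \<inter> B \<inter> C \<noteq> {}" "A \<inter> B \<inter> D \<noteq> {}" "A \<inter> C \<inter> D \<noteq> {}" "B \<inter> C \<inter> D \<noteq> {}"
  shows "Quad A B C D"
proof -
  have "W \<inter> A = A" "W \<inter> B = B" using subW assms(1,2) by (meson inf_absorb2)+
  then show ?thesis using assms unfolding Quad_def quad_def by simp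
qed

lemma Quad_in:
  assumes "Quad A B C D"
  shows "A \<in> HS" "B \<in> HS" "C \<in> HS" "D \<in> HS"
  using assms unfolding Quad_def by simp_all

lemma QuadD:
  assumes "Quad A B C D"
  shows "A \<subseteq> W" "B \<subseteq> W" "C \<subseteq> W" "D \<subseteq> W"
    "\<And>p. \<lbrakk>p \<in> A; p \<in> B; p \<in> C; p \<in> D\<rbrakk> \<Longrightarrow> False"
    "\<exists>p. p \<in> A \<and> p \<in> B \<and> p \<in> C" "\<exists>p. p \<in> A \<and> p \<in> B \<and> p \<in> D"
    "\<exists>p. p \<in> A \<and> p \<in> C \<and> p \<in> D" "\<exists>p. p \<in> B \<and> p \<in> C \<and> p \<in> D"
proof -
  show sub: "A \<subseteq> W" "B \<subseteq> W" "C \<subseteq> W" "D \<subseteq> W" using Quad_in[OF assms] subW by simp_all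
  have q: "quad W A B C D" using assms unfolding Quad_def by simp
  then show "\<exists>p. p \<in> A \<and> p \<in> B \<and> p \<in> C" "\<exists>p. p \<in> A \<and> p \<in> B \<and> p \<in> D"
    "\<exists>p. p \<in> A \<and> p \<in> C \<and> p \<in> D" "\<exists>p. p \<in> B \<and> p \<in> C \<and> p \<in> D"
    unfolding quad_def by auto
  fix p assume "p \<in> A" "p \<in> B" "p \<in> C" "p \<in> D"
  then have "p \<in> W \<inter> A \<inter> B \<inter> C \<inter> D" using sub by auto
  then show False using q unfolding quad_def by auto
qed

lemma Quad_swap12: "Quad A B C D \<Longrightarrow> Quad B A C D"
  and Quad_swap23: "Quad A B C D \<Longrightarrow> Quad A C B D"
  and Quad_swap34: "Quad A B C D \<Longrightarrow> Quad A B D C"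
  unfolding Quad_def quad_def by (simp_all add: Int_ac conj_ac)

lemma Quad_distinct:
  assumes "Quad A B C D"
  shows "A \<noteq> B" "A \<noteq> W - B" "A \<noteq> C" "A \<noteq> W - C" "A \<noteq> D" "A \<noteq> W - D"
    "B \<noteq> C" "B \<noteq> W - C" "B \<noteq> D" "B \<noteq> W - D" "C \<noteq> D" "C \<noteq> W - D"
proof -
  note Q = QuadD[OF assms]
  show "A \<noteq> B" "A \<noteq> W - B" using Q(5,6,8) by auto
  show "A \<noteq> C" "A \<noteq> W - C" using Q(5,6,7) by auto
  show "A \<noteq> D" "A \<noteq> W - D" using Q(5,6,7) by auto
  show "B \<noteq> C" "B \<noteq> W - C" using Q(5,6,7) by auto
  show "B \<noteq> D" "B \<noteq> W - D" using Q(5,6,7) by auto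
  show "C \<noteq> D" "C \<noteq> W - D" using Q(5,6,8) by auto
qed

section \<open>Rigidity in a minimal counterexample\<close>

lemma triple_not_subset:
  assumes q: "Quad A B C D" and L: "L \<in> HS" "L \<subset> A" "L \<noteq> {}"
  shows "\<not> A \<inter> B \<inter> C \<subseteq> L"
proof
  assume sub: "A \<inter> B \<inter> C \<subseteq> L"
  note In = Quad_in[OF q] and Q = QuadD[OF q]
  obtain x y where x: "x \<in> B" "x \<in> C" "x \<in> D" and y: "y \<in> A" "y \<in> B" "y \<in> C"
    using Q(6,9) by blast
  \<comment> \<open>The edge crossing \<open>A\<close> between \<open>x\<close> and \<open>y\<close>
    stays in \<open>B\<close> and \<open>C\<close>, so its inner end \<open>t\<close> falls into
    \<open>L\<close>. It crosses only \<open>A\<close>, hence its outer end \<open>s\<close> is in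
    \<open>L\<close> as well, although \<open>L\<close> lies inside \<open>A\<close>.\<close>
  have "x \<in> W" "x \<notin> A" using Q(2) Q(5)[of x] x by auto
  from edgeE[OF In(1) this y(1)] obtain s t where st: "s \<notin> A" "t \<in> A"
     "\<And>L. \<lbrakk>L \<in> HS; x \<in> L; y \<in> L\<rbrakk> \<Longrightarrow> s \<in> L \<and> t \<in> L"
     "\<And>L. \<lbrakk>L \<in> HS; L \<noteq> A; L \<noteq> W - A\<rbrakk> \<Longrightarrow> s \<in> L \<longleftrightarrow> t \<in> L" by metis
  have "t \<in> B" "t \<in> C" using st(3)[OF In(2)] st(3)[OF In(3)] x y by simp_all
  then have "t \<in> L" using st(2) sub by auto
  moreover have "L \<noteq> A" "L \<noteq> W - A" using L(2,3) by auto
  then have "s \<in> L \<longleftrightarrow> t \<in> L" using st(4)[OF L(1)] by simp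
  ultimately show False using L(2) st(1) by auto
qed

text \<open>Otherwise \<open>W - L\<close> would be a smaller ambient set: the triples involving
  \<open>A\<close> survive the removal of \<open>L\<close> by \<open>triple_not_subset\<close>, and
  the fourth one misses \<open>A\<close>, hence \<open>L\<close>.\<close>

lemma no_smaller:
  assumes q: "Quad A B C D" and L: "L \<in> HS" "L \<subset> A" "L \<noteq> {}"
  shows False
proof -
  note In = Quad_in[OF q] and Q = QuadD[OF q]
  have "W - L \<noteq> W" using L(3) subW[OF L(1)] by auto
  then have nq: "\<not> quad (W - L) A B C D" using minimal compl[OF L(1)] In by simp
  have "\<not> A \<inter> B \<inter> C \<subseteq> L" "\<not> A \<inter> B \<inter> D \<subseteq> L" "\<not> A \<inter> C \<inter> D \<subseteq> L"
    using triple_not_subset[OF q L] triple_not_subset[OF Quad_swap34[OF q] L]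
      triple_not_subset[OF Quad_swap34[OF Quad_swap23[OF q]] L] by simp_all
  then have "(W - L) \<inter> A \<inter> B \<inter> C \<noteq> {}" "(W - L) \<inter> A \<inter> B \<inter> D \<noteq> {}"
    "(W - L) \<inter> A \<inter> C \<inter> D \<noteq> {}" using Q(1) by auto
  moreover have "(W - L) \<inter> B \<inter> C \<inter> D \<noteq> {}" using Q(2,5,9) L(2) by auto
  moreover have "(W - L) \<inter> A \<inter> B \<inter> C \<inter> D = {}" using Q(5) by auto
  ultimately show False using nq unfolding quad_def by simp
qed

text \<open>Within the smaller ambient set \<open>L\<close> the only condition that can fail is that
  \<open>B \<inter> C \<inter> D\<close> meets \<open>L\<close>. Its failure lets \<open>L\<close>
  replace \<open>A\<close>, and then \<open>A\<close> lies strictly inside a member of a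
  quadruple.\<close>

lemma no_larger:
  assumes q: "Quad A B C D" and L: "L \<in> HS" "A \<subset> L" "L \<noteq> W"
  shows False
proof -
  note In = Quad_in[OF q] and Q = QuadD[OF q]
  have nq: "\<not> quad L A B C D" using minimal L In by simp
  have ne: "L \<inter> A \<inter> B \<inter> C \<noteq> {}" "L \<inter> A \<inter> B \<inter> D \<noteq> {}" "L \<inter> A \<inter> C \<inter> D \<noteq> {}"
    using Q(6-8) L(2) by auto
  moreover have "L \<inter> A \<inter> B \<inter> C \<inter> D = {}" using Q(5) by auto
  ultimately have "L \<inter> B \<inter> C \<inter> D = {}" using nq unfolding quad_def by simp
  then have "Quad L B C D"
  proof (rule QuadI[OF L(1) In(2-4)])
    show "L \<inter> B \<inter> C \<noteq> {}" "L \<inter> B \<inter> D \<noteq> {}" "L \<inter> C \<inter> D \<noteq> {}" "B \<inter> C \<inter> D \<noteq> {}"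
      using ne Q(9) by auto
  qed
  then show False using no_smaller[OF _ In(1) L(2)] Q(6) by auto
qed

section \<open>Prolonging geodesics, antipodes\<close>

lemma extend_into:
  assumes q: "Quad A B C D" and x: "x \<in> W" "x \<notin> A" and y: "y \<in> W"
  shows "\<exists>k\<in>A. btw HS x y k"
proof -
  note In = Quad_in[OF q] and Q = QuadD[OF q]
  have AW: "A \<inter> W = A" using Q(1) by blast
  then obtain H where H: "H \<in> HS" "A \<subseteq> H" "x \<notin> H"
      "(\<exists>L\<in>HS. A \<subseteq> L \<and> x \<in> L \<and> y \<notin> L) \<or> (\<exists>k\<in>W \<inter> H. btw HS x y k)"
    using prehull[OF W_in In(1), of x] x y Q(6) by (metis Diff_iff empty_iff)
  \<comment> \<open>\<open>A\<close> is a maximal proper halfspace, so \<open>H\<close> has to be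
    \<open>A\<close>, and the only halfspace containing both \<open>A\<close> and \<open>x\<close>
    is \<open>W\<close>, which cannot exclude \<open>y\<close>. What is left of the pre-hull
    condition is the prolongation.\<close>
  have sup: "L = A \<or> L = W" if "A \<subseteq> L" "L \<in> HS" for L
    using no_larger[OF q, of L] that by blast
  have "H = A" using sup[OF H(2,1)] H(3) x by blast
  moreover have "\<not> (\<exists>L\<in>HS. A \<subseteq> L \<and> x \<in> L \<and> y \<notin> L)"
    using sup x y by (metis)
  ultimately show ?thesis using H(4) by blast
qed

text \<open>Dual to \<open>extend_into\<close>: by \<open>no_smaller\<close> the complement of
  \<open>A\<close> is a maximal proper halfspace too.\<close>

lemma extend_out_of:
  assumes q: "Quad A B C D" and x: "x \<in> A" and y: "y \<in> W"
  shows "\<exists>k\<in>W - A. btw HS x y k"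
proof -
  note In = Quad_in[OF q] and Q = QuadD[OF q]
  have AW: "(W - A) \<inter> W = W - A" by blast
  have x': "x \<in> W - (W - A)" "W - A \<noteq> {}" using x Q(1,4,5,9) by blast+
  then obtain H where H: "H \<in> HS" "W - A \<subseteq> H" "x \<notin> H"
      "(\<exists>L\<in>HS. W - A \<subseteq> L \<and> x \<in> L \<and> y \<notin> L) \<or> (\<exists>k\<in>W \<inter> H. btw HS x y k)"
    using prehull[OF W_in compl[OF In(1)], unfolded AW, OF x'(2,1)] y by blast
  have sup: "L = W - A \<or> L = W" if "W - A \<subseteq> L" "L \<in> HS" for L
  proof (rule ccontr)
    assume neg: "\<not> ?thesis"
    have "W - L \<subset> A" "W - L \<noteq> {}" using that neg subW[OF that(2)] Q(1) by blast+
    then show False using no_smaller[OF q compl[OF that(2)]] by blast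
  qed
  have "H = W - A" using sup[OF H(2,1)] H(3) x' by blast
  moreover have "\<not> (\<exists>L\<in>HS. W - A \<subseteq> L \<and> x \<in> L \<and> y \<notin> L)"
    using sup x y by (metis Diff_iff)
  ultimately show ?thesis using H(4) by blast
qed

lemma btw_differ:
  assumes "btw HS x y k" "L \<in> HS" "x \<in> W" "k \<in> W" "y \<in> L \<longleftrightarrow> x \<notin> L"
  shows "k \<in> L \<longleftrightarrow> x \<notin> L"
  using assms(3-5) btw_in[OF assms(1,2)] btw_out[OF assms(1,2)] by auto

lemma extend_across:
  assumes "Quad A B C D" "x \<in> W" "y \<in> W"
  shows "\<exists>k\<in>W. btw HS x y k \<and> (k \<in> A \<longleftrightarrow> x \<notin> A)"
proof (cases "x \<in> A")
  case True
  then show ?thesis using extend_out_of[OF assms(1) _ assms(3)] by auto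
next
  case False
  then show ?thesis using extend_into[OF assms(1,2) _ assms(3)] QuadD(1)[OF assms(1)] by auto
qed

lemma btw_trans: "\<lbrakk>btw HS x y k; btw HS x k l\<rbrakk> \<Longrightarrow> btw HS x y l"
  unfolding btw_def by blast

text \<open>The geodesic is prolonged across one halfspace after another; by
  \<open>btw_differ\<close>, a halfspace once crossed is not crossed back.\<close>

lemma antipodal:
  assumes q: "Quad A B C D" and x: "x \<in> W" and y: "y \<in> W"
  obtains k where "k \<in> W" "btw HS x y k" "k \<in> A \<longleftrightarrow> x \<notin> A" "k \<in> B \<longleftrightarrow> x \<notin> B"
    "k \<in> C \<longleftrightarrow> x \<notin> C" "k \<in> D \<longleftrightarrow> x \<notin> D"
proof -
  note In = Quad_in[OF q] and Q = QuadD[OF q]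
  obtain k1 where 1: "k1 \<in> W" "btw HS x y k1" "k1 \<in> A \<longleftrightarrow> x \<notin> A"
    using extend_across[OF q x y] by blast
  obtain k2 where 2: "k2 \<in> W" "btw HS x k1 k2" "k2 \<in> B \<longleftrightarrow> x \<notin> B"
    using extend_across[OF Quad_swap12[OF q] x 1(1)] by blast
  obtain k3 where 3: "k3 \<in> W" "btw HS x k2 k3" "k3 \<in> C \<longleftrightarrow> x \<notin> C"
    using extend_across[OF Quad_swap12[OF Quad_swap23[OF q]] x 2(1)] by blast
  obtain k4 where 4: "k4 \<in> W" "btw HS x k3 k4" "k4 \<in> D \<longleftrightarrow> x \<notin> D"
    using extend_across[OF Quad_swap12[OF Quad_swap23[OF Quad_swap34[OF q]]] x 3(1)] by blast
  note b3 = btw_trans[OF 3(2) 4(2)]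
  note b2 = btw_trans[OF 2(2) b3]
  show thesis
    by (rule that[OF 4(1) btw_trans[OF 1(2) b2]])
      (use btw_differ[OF b2 In(1) x 4(1) 1(3)] btw_differ[OF b3 In(2) x 4(1) 2(3)]
        btw_differ[OF 4(2) In(3) x 4(1) 3(3)] 4(3) in blast)+
qed

text \<open>A geodesic from a point outside all four, prolonged through a point of
  \<open>B \<inter> C \<inter> D\<close> into \<open>A\<close>, would end inside all four.\<close>

lemma Quad_cover:
  assumes q: "Quad A B C D" and x: "x \<in> W"
  shows "x \<in> A \<or> x \<in> B \<or> x \<in> C \<or> x \<in> D"
proof (rule ccontr)
  assume neg: "\<not> ?thesis"
  note In = Quad_in[OF q] and Q = QuadD[OF q]
  obtain y where y: "y \<in> B" "y \<in> C" "y \<in> D" using Q(9) by blast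
  obtain k where "k \<in> A" "btw HS x y k" using extend_into[OF q x, of y] neg y Q(2) by blast
  then have k: "k \<in> A" "btw HS x y k" "k \<in> W" using Q(1) by blast+
  have "k \<in> B" "k \<in> C" "k \<in> D"
    using btw_differ[OF k(2) In(2) x k(3)] btw_differ[OF k(2) In(3) x k(3)]
      btw_differ[OF k(2) In(4) x k(3)] neg y by blast+
  then show False using Q(5)[of k] k(1) by blast
qed

section \<open>Pseudolines through a crossing point\<close>

lemma subset_Un:
  assumes q: "Quad A B C D" and L: "L \<in> HS" "A \<inter> B \<subseteq> L" "L \<noteq> B" "L \<noteq> W"
  shows "L \<subseteq> A \<union> B"
proof (rule ccontr)
  note In = Quad_in[OF q] and Q = QuadD[OF q]
  assume "\<not> ?thesis"
  then obtain p where p: "p \<in> L" "p \<notin> A" "p \<notin> B" by blast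
  have "\<not> B \<subset> L" using no_larger[OF Quad_swap12[OF q] L(1)] L(4) by blast
  then obtain r where r: "r \<in> B" "r \<notin> L" using L(3) by blast
  have W: "p \<in> W" "r \<in> W" using p r Q(2) subW[OF L(1)] by blast+
  \<comment> \<open>Beyond \<open>r\<close> the geodesic from \<open>p\<close> keeps the sides
    reached at \<open>r\<close>, inside \<open>B\<close> and outside \<open>L\<close>; so
    \<open>k\<close> is a point of \<open>A \<inter> B\<close> missing from
    \<open>L\<close>.\<close>
  obtain k where k: "k \<in> A" "btw HS p r k" using extend_into[OF q W(1) p(2) W(2)] by blast
  have "k \<in> W" using k(1) Q(1) by blast
  then have "k \<in> B" "k \<notin> L"
    using btw_differ[OF k(2) In(2) W(1)] btw_differ[OF k(2) L(1) W(1)] p r by blast+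
  then show False using k(1) L(2) by blast
qed

text \<open>The edge crossing \<open>A\<close> between \<open>z\<close> and \<open>k\<close> stays
  in \<open>C\<close>, \<open>D\<close> and \<open>K\<close>. Its end outside \<open>A\<close> is in
  \<open>K\<close>, hence in \<open>B\<close>; as the edge does not cross \<open>B\<close>, its
  other end would be common to all four.\<close>

lemma not_both:
  assumes q: "Quad A B C D" and K: "K \<in> HS" "K \<subseteq> A \<union> B"
    and z: "z \<in> B" "z \<in> C" "z \<in> D" "z \<in> K" and k: "k \<in> A" "k \<in> C" "k \<in> D" "k \<in> K"
  shows False
proof -
  note In = Quad_in[OF q] and Q = QuadD[OF q]
  have "z \<in> W" "z \<notin> A" using z Q(2) Q(5)[of z] by blast+
  from edgeE[OF In(1) this k(1)] obtain s t where st: "s \<notin> A" "t \<in> A"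
     "\<And>L. \<lbrakk>L \<in> HS; z \<in> L; k \<in> L\<rbrakk> \<Longrightarrow> s \<in> L \<and> t \<in> L"
     "\<And>L. \<lbrakk>L \<in> HS; L \<noteq> A; L \<noteq> W - A\<rbrakk> \<Longrightarrow> s \<in> L \<longleftrightarrow> t \<in> L" by metis
  have "s \<in> B \<longleftrightarrow> t \<in> B" using st(4)[OF In(2)] Quad_distinct(1,2)[OF q] Q(1,2) by blast
  moreover have "s \<in> K" "t \<in> C" "t \<in> D"
    using st(3)[OF K(1)] st(3)[OF In(3)] st(3)[OF In(4)] z k by blast+
  ultimately show False using st(1,2) K(2) Q(5)[of t] by blast
qed

text \<open>Reading halfspaces as pseudolines, \<^term>\<open>K\<close> below passes through the crossing point of
  \<^term>\<open>A\<close> and \<^term>\<open>B\<close>; the two alternatives of the pre-hull condition inside \<^term>\<open>A\<close> either give it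
  directly or give a halfspace contradicting \<open>Quad_cover\<close>.\<close>

lemma third_class:
  assumes q: "Quad A B C D" and x: "x \<in> A" "x \<notin> B" "x \<notin> C" "x \<notin> D"
    and y: "y \<in> A" "y \<in> C" "y \<in> D"
  obtains K where "K \<in> HS" "A \<inter> B \<subseteq> K" "K \<subseteq> A \<union> B" "x \<in> K" "y \<notin> K"
proof -
  note In = Quad_in[OF q] and Q = QuadD[OF q]
  have xW: "x \<in> W" and yW: "y \<in> W" using x(1) y(1) Q(1) by blast+
  obtain H where H: "H \<in> HS" "B \<inter> A \<subseteq> H" "x \<notin> H"
      "(\<exists>L\<in>HS. B \<inter> A \<subseteq> L \<and> x \<in> L \<and> y \<notin> L) \<or> (\<exists>k\<in>A \<inter> H. btw HS x y k)"
    using prehull[OF In(1,2), of x] x y Q(6) by blast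
  have "\<not> (\<exists>k\<in>A \<inter> H. btw HS x y k)"
  proof
    assume "\<exists>k\<in>A \<inter> H. btw HS x y k"
    then obtain k where k: "k \<in> A" "k \<in> H" "btw HS x y k" by blast
    have kW: "k \<in> W" using k(1) Q(1) by blast
    have k': "k \<in> C" "k \<in> D"
      using btw_differ[OF k(3) In(3) xW kW] btw_differ[OF k(3) In(4) xW kW] x y by blast+
    have "H \<noteq> B" "H \<noteq> W" using Q(5)[of k] k k' H(3) xW by blast+
    then have "H \<subseteq> A \<union> B" using subset_Un[OF q H(1)] H(2) by blast
    then have "B \<inter> C \<inter> D \<inter> H = {}" using not_both[OF q H(1) _ _ _ _ _ k(1) k' k(2)] by blast
    \<comment> \<open>By \<open>not_both\<close>, the presence of \<open>k\<close> keeps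
      \<open>B \<inter> C \<inter> D\<close> out of \<open>H\<close>, so \<open>H\<close> can
      replace \<open>A\<close>; but \<open>x\<close> is outside all four of the new
      quadruple.\<close>
    then have "Quad H B C D"
      using In H(1,2) k k' Q(6,7,9) by (intro QuadI) blast+
    then show False using Quad_cover[of H B C D x] x xW H by blast
  qed
  then obtain L where L: "L \<in> HS" "B \<inter> A \<subseteq> L" "x \<in> L" "y \<notin> L" using H by blast
  show thesis
    by (rule that[of L]) (use L subset_Un[OF q L(1)] x yW in blast)+
qed

text \<open>Witnesses for \<open>Quad_descent\<close>. The first three cells come from an edge
  crossing \<open>A\<close> or \<open>B\<close> between known points: \<open>K\<close> is a
  different pseudoline, so both ends are on the same side of it, and
  \<open>A \<inter> B \<subseteq> K \<subseteq> A \<union> B\<close> decides that side at one end.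
  The last cell is opposite to the third.\<close>

lemma third_class_cells:
  assumes q: "Quad A B C D" and K: "K \<in> HS" "A \<inter> B \<subseteq> K" "K \<subseteq> A \<union> B"
    and x: "x \<in> K" "x \<in> A" "x \<notin> B" "x \<notin> C" "x \<notin> D" and y: "y \<in> A" "y \<in> C" "y \<in> D" "y \<notin> K"
  shows "\<exists>p. p \<in> B \<and> p \<in> C \<and> p \<in> D \<and> p \<notin> K"
    and "\<exists>p. p \<in> A \<and> p \<notin> B \<and> p \<in> C \<and> p \<notin> D \<and> p \<in> K"
    and "\<exists>p. p \<in> W \<and> p \<notin> A \<and> p \<in> B \<and> p \<in> C \<and> p \<notin> D \<and> p \<in> K"
    and "\<exists>p. p \<in> A \<and> p \<notin> B \<and> p \<notin> C \<and> p \<in> D \<and> p \<notin> K"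
proof -
  note In = Quad_in[OF q] and Q = QuadD[OF q] and dist = Quad_distinct[OF q]
  have yB: "y \<notin> B" "y \<in> W" using y Q(5)[of y] Q(1) by blast+
  have KB: "K \<noteq> B" "K \<noteq> W - B" "K \<noteq> A" "K \<noteq> W - A"
  proof -
    obtain e where "e \<in> A" "e \<in> B" using Q(6) by blast
    then have "e \<in> K" using K(2) by blast
    then show "K \<noteq> B" "K \<noteq> W - B" "K \<noteq> A" "K \<noteq> W - A" using x y \<open>e \<in> A\<close> \<open>e \<in> B\<close> by blast+
  qed
  obtain d where d: "d \<in> A" "d \<in> B" "d \<in> C" using Q(6) by blast
  have dK: "d \<in> K" "d \<in> W" using d K(2) Q(1) by blast+
  obtain a where a: "a \<in> B" "a \<in> C" "a \<in> D" using Q(9) by blast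
  have aA: "a \<notin> A" "a \<in> W" using a Q(5)[of a] Q(2) by blast+
  show "\<exists>p. p \<in> B \<and> p \<in> C \<and> p \<in> D \<and> p \<notin> K"
  proof (rule ccontr)
    assume neg: "\<not> ?thesis"
    from edgeE[OF In(2) yB(2,1) a(1)] obtain s t where st: "s \<notin> B" "t \<in> B"
      "\<And>L. \<lbrakk>L \<in> HS; y \<in> L; a \<in> L\<rbrakk> \<Longrightarrow> s \<in> L \<and> t \<in> L"
      "\<And>L. \<lbrakk>L \<in> HS; L \<noteq> B; L \<noteq> W - B\<rbrakk> \<Longrightarrow> s \<in> L \<longleftrightarrow> t \<in> L" by metis
    have "t \<in> C" "t \<in> D" using st(3)[OF In(3)] st(3)[OF In(4)] y a by blast+
    moreover have "t \<in> K" using neg st(2) calculation by blast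
    moreover have "s \<in> A \<longleftrightarrow> t \<in> A" "s \<in> K \<longleftrightarrow> t \<in> K"
      using st(4)[OF In(1) dist(1,2)] st(4)[OF K(1) KB(1,2)] by blast+
    ultimately show False using st(1,2) K(3) Q(5)[of t] by blast
  qed
  show "\<exists>p. p \<in> A \<and> p \<notin> B \<and> p \<in> C \<and> p \<notin> D \<and> p \<in> K"
  proof -
    from edgeE[OF In(2) yB(2,1) d(2)] obtain s t where st: "s \<notin> B" "t \<in> B"
      "\<And>L. \<lbrakk>L \<in> HS; y \<in> L; d \<in> L\<rbrakk> \<Longrightarrow> s \<in> L \<and> t \<in> L"
      "\<And>L. \<lbrakk>L \<in> HS; L \<noteq> B; L \<noteq> W - B\<rbrakk> \<Longrightarrow> s \<in> L \<longleftrightarrow> t \<in> L" by metis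
    have "t \<in> A" "t \<in> C" "s \<in> A" "s \<in> C" using st(3)[OF In(1)] st(3)[OF In(3)] y d by blast+
    moreover have "s \<in> D \<longleftrightarrow> t \<in> D" "s \<in> K \<longleftrightarrow> t \<in> K"
      using st(4)[OF In(4)] dist(9,10) Q(2,4) st(4)[OF K(1) KB(1,2)] by blast+
    ultimately show ?thesis using st(1,2) K(2) Q(5)[of t] by blast
  qed
  show "\<exists>p. p \<in> W \<and> p \<notin> A \<and> p \<in> B \<and> p \<in> C \<and> p \<notin> D \<and> p \<in> K"
  proof -
    from edgeE[OF In(1) aA(2,1) d(1)] obtain s t where st: "s \<notin> A" "t \<in> A"
      "\<And>L. \<lbrakk>L \<in> HS; a \<in> L; d \<in> L\<rbrakk> \<Longrightarrow> s \<in> L \<and> t \<in> L"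
      "\<And>L. \<lbrakk>L \<in> HS; L \<noteq> A; L \<noteq> W - A\<rbrakk> \<Longrightarrow> s \<in> L \<longleftrightarrow> t \<in> L" "s \<in> W" by metis
    have "t \<in> B" "t \<in> C" "s \<in> B" "s \<in> C" using st(3)[OF In(2)] st(3)[OF In(3)] a d by blast+
    moreover have "s \<in> D \<longleftrightarrow> t \<in> D" "s \<in> K \<longleftrightarrow> t \<in> K"
      using st(4)[OF In(4)] dist(5,6) Q(1,4) st(4)[OF K(1) KB(3,4)] by blast+
    ultimately show ?thesis using st(1,2,5) K(2) Q(5)[of t] by blast
  qed
  then obtain p where p: "p \<in> W" "p \<notin> A" "p \<in> B" "p \<in> C" "p \<notin> D" "p \<in> K" by blast
  \<comment> \<open>Going through \<open>y\<close>, which is outside \<open>K\<close>, ensures that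
    the antipode of \<open>p\<close> is outside \<open>K\<close> as well.\<close>
  obtain k where k: "k \<in> W" "btw HS p y k" "k \<in> A \<longleftrightarrow> p \<notin> A" "k \<in> B \<longleftrightarrow> p \<notin> B"
    "k \<in> C \<longleftrightarrow> p \<notin> C" "k \<in> D \<longleftrightarrow> p \<notin> D" using antipodal[OF q p(1) yB(2)] by metis
  have "k \<notin> K" using btw_differ[OF k(2) K(1) p(1) k(1)] p(6) y(4) by blast
  then show "\<exists>p. p \<in> A \<and> p \<notin> B \<and> p \<notin> C \<and> p \<in> D \<and> p \<notin> K" using k p by blast
qed

text \<open>If \<^term>\<open>K\<close> is in general position with three of the four pseudolines, it cuts the triangle
  \<^term>\<open>A \<inter> C - B\<close> into a smaller one. Otherwise it also passes through the crossing point of \<^term>\<open>C\<close> and \<^term>\<open>D\<close>,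
  and a further pseudoline \<^term>\<open>Y\<close> through the crossing point of \<^term>\<open>A\<close> and \<^term>\<open>D\<close> restores general position.\<close>

lemma Quad_descent:
  assumes q: "Quad A B C D"
  shows "\<exists>A' B' C' D'. Quad A' B' C' D' \<and> A' \<inter> C' - B' \<subset> A \<inter> C - B"
proof -
  note In = Quad_in[OF q] and Q = QuadD[OF q] and dist = Quad_distinct[OF q]
  have q': "Quad A D B C" using q Quad_swap34 Quad_swap23 by blast
  obtain a where a: "a \<in> B" "a \<in> C" "a \<in> D" using Q(9) by blast
  obtain b where b: "b \<in> A" "b \<in> C" "b \<in> D" using Q(8) by blast
  obtain c where c: "c \<in> A" "c \<in> B" "c \<in> D" using Q(7) by blast
  obtain d where d: "d \<in> A" "d \<in> B" "d \<in> C" using Q(6) by blast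
  have aW: "a \<in> W" "a \<notin> A" using a Q(2) Q(5)[of a] by blast+
  \<comment> \<open>An antipode of \<open>a\<close>, hence inside \<open>A\<close> only.\<close>
  then obtain x where x: "x \<in> W" "x \<in> A" "x \<notin> B" "x \<notin> C" "x \<notin> D"
    using antipodal[OF q aW(1) aW(1)] a by metis
  obtain K where K: "K \<in> HS" "A \<inter> B \<subseteq> K" "K \<subseteq> A \<union> B" "x \<in> K" "b \<notin> K"
    using third_class[OF q x(2-) b] by metis
  note cells = third_class_cells[OF q K(1-4) x(2-) b K(5)]
    and cells' = third_class_cells[OF Quad_swap34[OF q] K(1-4) x(2,3,5,4) b(1,3,2) K(5)]
  obtain p where p: "p \<in> A" "p \<notin> B" "p \<in> C" "p \<notin> D" "p \<in> K" using cells(2) by blast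
  have cd: "c \<in> K" "d \<in> K" using c d K(2) by blast+
  show ?thesis
  proof (cases "C \<inter> D \<inter> K = {}")
    case False
    then obtain r where r: "r \<in> C" "r \<in> D" "r \<in> K" by blast
    show ?thesis
    proof (cases "r \<in> A")
      case True
      then have "B \<inter> C \<inter> D \<inter> K = {}" using not_both[OF q K(1,3) _ _ _ _ True r] by blast
      \<comment> \<open>\<open>K\<close> replaces \<open>A\<close>: outside \<open>B\<close> it is
        contained in \<open>A\<close>, and \<open>b\<close> drops out of the triangle.\<close>
      then have "Quad K B C D" using In K(1) r cd a b c d \<open>r \<in> A\<close> by (intro QuadI) blast+
      moreover have "K \<inter> C - B \<subset> A \<inter> C - B" using K(3,5) b Q(5)[of b] by blast
      ultimately show ?thesis by blast
    next
      case False
      then have rB: "r \<in> B" using r K(3) by blast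
      then have "A \<inter> C \<inter> D \<inter> K = {}" using not_both[OF q K(1,3) rB r] by blast
      \<comment> \<open>\<open>K\<close> replaces \<open>B\<close>: it contains
        \<open>A \<inter> B\<close>, and \<open>p\<close> drops out of the triangle.\<close>
      then have "Quad A K C D" using In K(1) r cd a b c d by (intro QuadI) blast+
      moreover have "A \<inter> C - K \<subset> A \<inter> C - B" using K(2) p by blast
      ultimately show ?thesis by blast
    qed
  next
    case CDK: True
    \<comment> \<open>With \<open>CDK\<close> this places the complement of \<open>K\<close> between
      \<open>C \<inter> D\<close> and \<open>C \<union> D\<close>. A point \<open>r\<close>
      violating it could be prolonged through \<open>c\<close> to a point of
      \<open>C \<inter> D \<inter> K\<close>.\<close>
    have K': "W - C - D \<subseteq> K"
    proof (rule ccontr)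
      assume "\<not> ?thesis"
      then obtain r where r: "r \<in> W" "r \<notin> C" "r \<notin> D" "r \<notin> K" by blast
      have "c \<in> W" using c(1) Q(1) by blast
      then obtain k where k: "k \<in> C" "btw HS r c k"
        using extend_into[OF Quad_swap12[OF Quad_swap23[OF q]] r(1,2)] by blast
      have kW: "k \<in> W" using k(1) Q(3) by blast
      have "k \<in> D" "k \<in> K"
        using btw_differ[OF k(2) In(4) r(1) kW] btw_differ[OF k(2) K(1) r(1) kW] r c cd by blast+
      then show False using k CDK by blast
    qed
    obtain Y where Y: "Y \<in> HS" "A \<inter> D \<subseteq> Y" "Y \<subseteq> A \<union> D" "x \<in> Y" "d \<notin> Y"
      using third_class[OF q' x(2,5,3,4) d] by metis
    note Ycells = third_class_cells[OF q' Y(1-4) x(2,5,3,4) d Y(5)]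
      and Ycells' = third_class_cells[OF Quad_swap34[OF q'] Y(1-4) x(2,5,4,3) d(1,3,2) Y(5)]
    obtain z where z: "z \<in> D" "z \<in> B" "z \<in> C" "z \<notin> Y" using Ycells(1) by blast
    have z': "z \<in> W" "z \<notin> K" using z Q(2) CDK by blast+
    \<comment> \<open>Both \<open>g\<close> and the later \<open>h\<close> lie in \<open>K\<close>
      and \<open>Y\<close>, while \<open>z\<close> lies in neither. Their antipodes beyond
      \<open>z\<close> are therefore outside \<open>K\<close> and \<open>Y\<close>, one inside
      \<open>A\<close> and one outside \<open>C\<close>, as two triples of the final quadruple
      demand.\<close>
    have "\<exists>g. g \<in> W \<and> g \<notin> A \<and> g \<in> B \<and> g \<notin> C \<and> g \<in> D \<and> g \<in> K \<and> g \<in> Y"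
    proof -
      obtain r where r: "r \<in> W" "r \<notin> A" "r \<in> B" "r \<in> D" "r \<in> K" using cells'(3) by blast
      from edgeE[OF In(1) r(1,2) c(1)] obtain s t where st: "s \<in> W" "s \<notin> A" "t \<in> A"
        "\<And>L. \<lbrakk>L \<in> HS; r \<in> L; c \<in> L\<rbrakk> \<Longrightarrow> s \<in> L \<and> t \<in> L"
        "\<And>L. \<lbrakk>L \<in> HS; L \<noteq> A; L \<noteq> W - A\<rbrakk> \<Longrightarrow> s \<in> L \<longleftrightarrow> t \<in> L" by metis
      have "s \<in> B" "t \<in> B" "s \<in> D" "t \<in> D" "s \<in> K"
        using st(4)[OF In(2)] st(4)[OF In(4)] st(4)[OF K(1)] r c cd by blast+
      moreover have YA: "Y \<noteq> A" "Y \<noteq> W - A" using Y(2,5) d(1) b(1,3) by blast+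
      then have "s \<in> C \<longleftrightarrow> t \<in> C" "s \<in> Y \<longleftrightarrow> t \<in> Y"
        using st(5)[OF In(3)] dist(3,4) Q(1,3) st(5)[OF Y(1) YA] by blast+
      ultimately show ?thesis using st(1-3) Y(2) Q(5)[of t] by blast
    qed
    then obtain g where g: "g \<in> W" "g \<notin> A" "g \<in> B" "g \<notin> C" "g \<in> D" "g \<in> K" "g \<in> Y" by blast
    obtain g' where g': "g' \<in> W" "btw HS g z g'" "g' \<in> A \<longleftrightarrow> g \<notin> A" "g' \<in> B \<longleftrightarrow> g \<notin> B"
      "g' \<in> C \<longleftrightarrow> g \<notin> C" "g' \<in> D \<longleftrightarrow> g \<notin> D" using antipodal[OF q g(1) z'(1)] by metis
    have g'': "g' \<in> A" "g' \<notin> K" "g' \<notin> Y"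
      using g'(3) btw_differ[OF g'(2) K(1) g(1) g'(1)] btw_differ[OF g'(2) Y(1) g(1) g'(1)]
        g z z' by blast+
    have "\<exists>h. h \<in> A \<and> h \<notin> B \<and> h \<in> C \<and> h \<notin> D \<and> h \<in> K \<and> h \<in> Y"
    proof -
      obtain r where r: "r \<in> A" "r \<notin> B" "r \<in> C" "r \<notin> D" "r \<in> Y" using Ycells'(2) by blast
      from edgeE[OF In(3) x(1,4) r(3)] obtain s t where st: "s \<in> W" "s \<notin> C" "t \<in> C"
        "\<And>L. \<lbrakk>L \<in> HS; x \<in> L; r \<in> L\<rbrakk> \<Longrightarrow> s \<in> L \<and> t \<in> L"
        "\<And>L. \<lbrakk>L \<in> HS; L \<noteq> C; L \<noteq> W - C\<rbrakk> \<Longrightarrow> s \<in> L \<longleftrightarrow> t \<in> L" by metis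
      have "r \<in> W" using r(1) Q(1) by blast
      then have "s \<notin> D" "t \<notin> D" "t \<notin> B" "t \<in> A" "t \<in> Y"
        using st(4)[OF In(1)] st(4)[OF Y(1)] st(4)[OF compl[OF In(2)]] st(4)[OF compl[OF In(4)]]
          x r Y(4) by blast+
      moreover have "s \<in> K" using K' st(1,2) calculation by blast
      moreover have KC: "K \<noteq> C" "K \<noteq> W - C" using K(5) b(2) d(3) cd by blast+
      have "s \<in> K \<longleftrightarrow> t \<in> K" using st(5)[OF K(1) KC] by blast
      ultimately show ?thesis using st(3) by blast
    qed
    then obtain h where h: "h \<in> A" "h \<notin> B" "h \<in> C" "h \<notin> D" "h \<in> K" "h \<in> Y" by blast
    have hW: "h \<in> W" using h(1) Q(1) by blast
    obtain h' where h': "h' \<in> W" "btw HS h z h'" "h' \<in> A \<longleftrightarrow> h \<notin> A" "h' \<in> B \<longleftrightarrow> h \<notin> B"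
      "h' \<in> C \<longleftrightarrow> h \<notin> C" "h' \<in> D \<longleftrightarrow> h \<notin> D" using antipodal[OF q hW z'(1)] by metis
    have h'': "h' \<notin> C" "h' \<notin> K" "h' \<notin> Y"
      using h'(5) btw_differ[OF h'(2) K(1) hW h'(1)] btw_differ[OF h'(2) Y(1) hW h'(1)]
        h z z' by blast+
    obtain u where u: "u \<in> A" "u \<notin> C" "u \<notin> K" using cells(4) by blast
    obtain v where v: "v \<in> A" "v \<notin> C" "v \<notin> Y" using Ycells'(4) by blast
    have "Quad A (W - C) (W - K) (W - Y)"
      using In(1) compl[OF In(3)] compl[OF K(1)] compl[OF Y(1)]
    proof (rule QuadI)
      \<comment> \<open>By \<open>K'\<close> a point outside \<open>C\<close> and \<open>K\<close>
        is in \<open>D\<close>, and \<open>A \<inter> D\<close> lies in \<open>Y\<close>.\<close>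
      show "A \<inter> (W - C) \<inter> (W - K) \<inter> (W - Y) = {}" using K' Y(2) Q(1) by blast
      show "A \<inter> (W - C) \<inter> (W - K) \<noteq> {}" using u Q(1) by blast
      show "A \<inter> (W - C) \<inter> (W - Y) \<noteq> {}" using v Q(1) by blast
      show "A \<inter> (W - K) \<inter> (W - Y) \<noteq> {}" using g'' g' by blast
      show "(W - C) \<inter> (W - K) \<inter> (W - Y) \<noteq> {}" using h'' h' by blast
    qed
    moreover have "A \<inter> (W - K) - (W - C) \<subset> A \<inter> C - B" using K(2) p Q(1) by blast
    ultimately show ?thesis by blast
  qed
qed

theorem no_Quad: "\<not> Quad A B C D"
proof (induction "card (A \<inter> C - B)" arbitrary: A B C D rule: less_induct)
  case less
  show ?case
  proof
    assume q: "Quad A B C D"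
    from Quad_descent[OF this] obtain A' B' C' D'
      where q': "Quad A' B' C' D'" "A' \<inter> C' - B' \<subset> A \<inter> C - B"
      by (elim exE conjE) (rule that)
    have "finite A" using QuadD(1)[OF q] finW by (rule finite_subset)
    then have "card (A' \<inter> C' - B') < card (A \<inter> C - B)"
      using q'(2) by (intro psubset_card_mono) auto
    then show False using less q'(1) by simp
  qed
qed

end

section \<open>Convexity in partial cubes\<close>

lemma walk_not_Nil: "walk V E p \<Longrightarrow> p \<noteq> []"
  by (cases p) auto

lemma walk_set: "walk V E p \<Longrightarrow> set p \<subseteq> V"
  by (induction V E p rule: walk.induct) auto

lemma walk_append: "walk V E (p @ [z]) \<Longrightarrow> walk V E (z # q) \<Longrightarrow> walk V E (p @ z # q)"
proof (induction p)
  case (Cons a p)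
  then show ?case by (cases p) auto
qed simp

lemma walk_split: "walk V E (p @ z # q) \<Longrightarrow> walk V E (p @ [z]) \<and> walk V E (z # q)"
proof (induction p)
  case Nil
  then show ?case by (cases q) auto
next
  case (Cons a p)
  then show ?case by (cases p) auto
qed

lemma gdist_le: "walk_betw V E x y p \<Longrightarrow> length p = Suc n \<Longrightarrow> gdist V E x y \<le> n"
  unfolding gdist_def by (rule Least_le) blast

lemma shortest_walk:
  assumes "walk_betw V E x y q"
  obtains p where "walk_betw V E x y p" "length p = Suc (gdist V E x y)"
proof -
  have "q \<noteq> []" using assms walk_not_Nil unfolding walk_betw_def by blast
  then have "\<exists>n p. walk_betw V E x y p \<and> length p = Suc n" using assms
    by (intro exI[of _ "length q - 1"] exI[of _ q]) simp
  then have "\<exists>p. walk_betw V E x y p \<and> length p = Suc (gdist V E x y)"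
    unfolding gdist_def by (rule LeastI_ex)
  then show thesis using that by blast
qed

lemma gconvex_Int: "gconvex V E A \<Longrightarrow> gconvex V E B \<Longrightarrow> gconvex V E (A \<inter> B)"
  unfolding gconvex_def by blast

lemma gconvexD: "gconvex V E A \<Longrightarrow> x \<in> A \<Longrightarrow> y \<in> A \<Longrightarrow> z \<in> interval V E x y \<Longrightarrow> z \<in> A"
  unfolding gconvex_def by blast

lemma walk_induced:
  "Z \<subseteq> V \<Longrightarrow> walk Z (induced_adj E Z) p \<longleftrightarrow> walk V E p \<and> set p \<subseteq> Z"
  by (induction V E p rule: walk.induct) (auto simp: induced_adj_def)

lemma walk_betw_induced:
  "Z \<subseteq> V \<Longrightarrow> walk_betw Z (induced_adj E Z) x y p \<longleftrightarrow> walk_betw V E x y p \<and> set p \<subseteq> Z"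
  unfolding walk_betw_def by (auto simp: walk_induced)

lemma shortest_walk_in_convex:
  assumes "gconvex V E Z" "x \<in> Z" "y \<in> Z" "walk_betw V E x y p" "length p = Suc (gdist V E x y)"
  shows "walk_betw Z (induced_adj E Z) x y p"
proof -
  have "set p \<subseteq> interval V E x y" using assms(4,5) unfolding interval_def by blast
  then have "set p \<subseteq> Z" using gconvexD[OF assms(1-3)] by auto
  then show ?thesis using assms(1,4) walk_betw_induced[of Z V] unfolding gconvex_def by simp
qed

lemma gdist_induced:
  assumes "connected_graph V E" "gconvex V E Z" "x \<in> Z" "y \<in> Z"
  shows "gdist Z (induced_adj E Z) x y = gdist V E x y"
proof -
  have Z: "Z \<subseteq> V" using assms(2) unfolding gconvex_def by blast
  then obtain q where "walk_betw V E x y q" using assms unfolding connected_graph_def by blast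
  then obtain p where p: "walk_betw V E x y p" "length p = Suc (gdist V E x y)"
    by (rule shortest_walk)
  note p' = shortest_walk_in_convex[OF assms(2-4) p]
  then obtain r where r: "walk_betw Z (induced_adj E Z) x y r"
      "length r = Suc (gdist Z (induced_adj E Z) x y)"
    by (rule shortest_walk)
  show ?thesis
    using gdist_le[OF p' p(2)] gdist_le[OF _ r(2), of V E x y] r(1) walk_betw_induced[OF Z] by simp
qed

lemma interval_induced:
  assumes "connected_graph V E" "gconvex V E Z" "x \<in> Z" "y \<in> Z"
  shows "interval Z (induced_adj E Z) x y = interval V E x y"
proof -
  have "Z \<subseteq> V" using assms(2) unfolding gconvex_def by blast
  note iff = walk_betw_induced[OF this, of E x y]
  have "walk_betw Z (induced_adj E Z) x y p \<longleftrightarrow> walk_betw V E x y p"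
    if "length p = Suc (gdist V E x y)" for p
    using shortest_walk_in_convex[OF assms(2-4) _ that] iff[of p] by auto
  then show ?thesis unfolding interval_def gdist_induced[OF assms] by auto
qed

text \<open>Shortest walks between points of \<open>Z\<close> stay in \<open>Z\<close>, so distances
  and intervals agree. This carries the pre-hull condition, stated inside the subgraph, over to
  convexity in \<open>V\<close>.\<close>

lemma gconvex_induced:
  assumes "connected_graph V E" "gconvex V E Z"
  shows "gconvex Z (induced_adj E Z) A \<longleftrightarrow> A \<subseteq> Z \<and> gconvex V E A"
proof -
  have "Z \<subseteq> V" using assms(2) unfolding gconvex_def by simp
  show ?thesis
  proof (cases "A \<subseteq> Z")
    case True
    then have "interval Z (induced_adj E Z) x y = interval V E x y" if "x \<in> A" "y \<in> A" for x y
      using interval_induced[OF assms] that by auto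
    moreover have "A \<subseteq> V" using True \<open>Z \<subseteq> V\<close> by simp
    ultimately show ?thesis using True unfolding gconvex_def by simp
  qed (simp add: gconvex_def)
qed

section \<open>Intervals as traces of subcubes\<close>

definition sdiff :: "'b set \<Rightarrow> 'b set \<Rightarrow> 'b set" where
  "sdiff S T = (S - T) \<union> (T - S)"

text \<open>The detour through \<open>U\<close> costs twice the number of coordinates flipped on
  both legs, and no coordinate is flipped twice exactly when \<open>U\<close> lies between
  \<open>S\<close> and \<open>T\<close>.\<close>

lemma card_sdiff_between:
  assumes "finite S" "finite T" "finite U"
  shows "card (sdiff S U) + card (sdiff U T) = card (sdiff S T) \<longleftrightarrow> S \<inter> T \<subseteq> U \<and> U \<subseteq> S \<union> T"
    and "card (sdiff S T) \<le> card (sdiff S U) + card (sdiff U T)"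
proof -
  let ?I = "sdiff S U \<inter> sdiff U T"
  have fin: "finite (sdiff S U)" "finite (sdiff U T)" "finite (sdiff S T)" "finite ?I"
    using assms unfolding sdiff_def by auto
  have "sdiff S U \<union> sdiff U T = sdiff S T \<union> ?I" "sdiff S T \<inter> ?I = {}"
    unfolding sdiff_def by auto
  then have "card (sdiff S U) + card (sdiff U T) = card (sdiff S T) + 2 * card ?I"
    using card_Un_Int[OF fin(1,2)] card_Un_disjoint[OF fin(3,4)] by simp
  moreover have "?I = {} \<longleftrightarrow> S \<inter> T \<subseteq> U \<and> U \<subseteq> S \<union> T"
    unfolding sdiff_def by auto
  ultimately show "card (sdiff S U) + card (sdiff U T) = card (sdiff S T) \<longleftrightarrow> S \<inter> T \<subseteq> U \<and> U \<subseteq> S \<union> T"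
    and "card (sdiff S T) \<le> card (sdiff S U) + card (sdiff U T)"
    using fin(4) by auto
qed

locale isometric_embedding =
  fixes V :: "'a set" and E :: "'a \<Rightarrow> 'a \<Rightarrow> bool" and f :: "'a \<Rightarrow> 'b set"
  assumes conn: "connected_graph V E"
    and fin: "v \<in> V \<Longrightarrow> finite (f v)"
    and dist: "u \<in> V \<Longrightarrow> v \<in> V \<Longrightarrow> gdist V E u v = card (sdiff (f u) (f v))"
begin

lemma shortest:
  assumes "x \<in> V" "y \<in> V"
  obtains p where "walk_betw V E x y p" "length p = Suc (gdist V E x y)"
proof -
  obtain q where "walk_betw V E x y q" using conn assms unfolding connected_graph_def by blast
  then show thesis by (rule shortest_walk) (rule that)
qed

lemma triangle:
  assumes "x \<in> V" "y \<in> V" "z \<in> V"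
  shows "gdist V E x y \<le> gdist V E x z + gdist V E z y"
  using card_sdiff_between(2)[OF fin fin fin, OF assms] dist assms by simp

text \<open>Lying on a shortest walk means equality in the triangle inequality, which
  \<open>card_sdiff_between\<close> turns into betweenness of coordinate sets.\<close>

lemma interval_iff:
  assumes "x \<in> V" "y \<in> V"
  shows "z \<in> interval V E x y \<longleftrightarrow> z \<in> V \<and> f x \<inter> f y \<subseteq> f z \<and> f z \<subseteq> f x \<union> f y"
proof -
  have "z \<in> interval V E x y \<longleftrightarrow> z \<in> V \<and> gdist V E x z + gdist V E z y = gdist V E x y"
  proof
    assume "z \<in> interval V E x y"
    then obtain p where p: "walk_betw V E x y p" "length p = Suc (gdist V E x y)" "z \<in> set p"
      unfolding interval_def by blast
    then have zV: "z \<in> V" using walk_set[of V E p] unfolding walk_betw_def by auto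
    obtain q r where qr: "p = q @ z # r" using p(3) by (meson split_list)
    then have w: "walk V E (q @ [z])" "walk V E (z # r)"
      using p(1) walk_split[of V E q z r] unfolding walk_betw_def by simp_all
    have "walk_betw V E x z (q @ [z])" "walk_betw V E z y (z # r)"
      using w p(1) unfolding qr walk_betw_def by (auto simp: hd_append)
    from gdist_le[OF this(1)] gdist_le[OF this(2)]
    have "gdist V E x z \<le> length q" "gdist V E z y \<le> length r" by simp_all
    then show "z \<in> V \<and> gdist V E x z + gdist V E z y = gdist V E x y"
      using triangle[OF assms zV] p(2) zV unfolding qr by simp
  next
    assume z: "z \<in> V \<and> gdist V E x z + gdist V E z y = gdist V E x y"
    then have zV: "z \<in> V" by simp
    obtain p where p: "walk_betw V E x z p" "length p = Suc (gdist V E x z)"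
      by (rule shortest[OF assms(1) zV])
    obtain q where q: "walk_betw V E z y q" "length q = Suc (gdist V E z y)"
      by (rule shortest[OF zV assms(2)])
    obtain q' where q': "q = z # q'" using q unfolding walk_betw_def by (cases q) auto
    moreover obtain p' where "p = p' @ [z]"
      using p unfolding walk_betw_def by (cases p rule: rev_cases) auto
    ultimately have pq: "p = p' @ [z]" "q = z # q'" by auto
    have "walk V E (p' @ z # q')"
      using walk_append[of V E p' z q'] p(1) q(1) unfolding pq walk_betw_def by simp
    moreover have "hd (p' @ z # q') = x" "last (p' @ z # q') = y"
      using p(1) q(1) unfolding pq walk_betw_def by (auto simp: hd_append)
    moreover have "length (p' @ z # q') = Suc (gdist V E x y)" using p(2) q(2) z unfolding pq by simp
    ultimately show "z \<in> interval V E x y" unfolding interval_def walk_betw_def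
      by (intro CollectI exI[of _ "p' @ z # q'"]) simp
  qed
  then show ?thesis using card_sdiff_between(1)[OF fin fin fin, of x y z] dist assms by auto
qed

lemma f_inj: "u \<in> V \<Longrightarrow> v \<in> V \<Longrightarrow> f u = f v \<Longrightarrow> u = v"
proof -
  assume uv: "u \<in> V" "v \<in> V" "f u = f v"
  then have "gdist V E u v = 0" using dist unfolding sdiff_def by simp
  then obtain p where "walk_betw V E u v p" "length p = Suc 0"
    using shortest[OF uv(1,2)] by auto
  then show "u = v" unfolding walk_betw_def by (auto simp: length_Suc_conv)
qed

lemma gconvex_interval:
  assumes "u \<in> V" "v \<in> V"
  shows "gconvex V E (interval V E u v)"
  unfolding gconvex_def
proof (intro conjI ballI subsetI)
  show "z \<in> V" if "z \<in> interval V E u v" for z using that interval_iff[OF assms] by blast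
next
  fix x y z assume xy: "x \<in> interval V E u v" "y \<in> interval V E u v" and z: "z \<in> interval V E x y"
  have V: "x \<in> V" "y \<in> V" using xy interval_iff[OF assms] by simp_all
  then show "z \<in> interval V E u v"
    using interval_iff[OF assms, of x] interval_iff[OF assms, of y] interval_iff[OF assms, of z]
      interval_iff[OF V, of z] xy z by blast
qed

section \<open>Crossing edges, separation, copoints\<close>

lemma first_step:
  assumes "x \<in> V" "y \<in> V" "x \<noteq> y"
  obtains z e where "z \<in> interval V E x y" "sdiff (f x) (f z) = {e}" "gdist V E z y < gdist V E x y"
proof -
  obtain p where p: "walk_betw V E x y p" "length p = Suc (gdist V E x y)"
    by (rule shortest[OF assms(1,2)])
  then obtain z q where q: "p = x # z # q"
    using assms(3) unfolding walk_betw_def by (cases p; cases "tl p") auto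
  have z: "z \<in> V" using p(1) walk_set[of V E p] unfolding q walk_betw_def by auto
  have "walk_betw V E x z [x, z]" "walk_betw V E z y (z # q)"
    using p(1) z unfolding q walk_betw_def by auto
  from gdist_le[OF this(1)] gdist_le[OF this(2)]
  have d: "gdist V E x z \<le> 1" "gdist V E z y \<le> length q" by simp_all
  moreover have len: "gdist V E x y = Suc (length q)" using p(2) unfolding q by simp
  ultimately have "gdist V E x z = 1" using triangle[OF assms(1,2) z] by simp
  then have "card (sdiff (f x) (f z)) = 1" using dist assms(1) z by simp
  then obtain e where "sdiff (f x) (f z) = {e}" by (rule card_1_singletonE)
  moreover have "z \<in> interval V E x y" using p q unfolding interval_def by auto
  moreover have "gdist V E z y < gdist V E x y" using d len by simp
  ultimately show thesis using that by blast
qed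

lemma interval_ends: "x \<in> V \<Longrightarrow> y \<in> V \<Longrightarrow> x \<in> interval V E x y \<and> y \<in> interval V E x y"
  using interval_iff by auto

lemma interval_commute: "x \<in> V \<Longrightarrow> y \<in> V \<Longrightarrow> interval V E x y = interval V E y x"
  using interval_iff by (auto simp: Int_commute Un_commute)

text \<open>Among the points of the interval on the side of \<open>x\<close>, the one closest to
  \<open>y\<close> must change coordinate \<open>e\<close> in its next step towards
  \<open>y\<close>.\<close>

lemma crossing_edge:
  assumes "x \<in> V" "y \<in> V" "(e \<in> f x) \<noteq> (e \<in> f y)"
  obtains s t where "s \<in> interval V E x y" "t \<in> interval V E x y"
    "e \<in> f s \<longleftrightarrow> e \<in> f x" "e \<in> f t \<longleftrightarrow> e \<in> f y" "sdiff (f s) (f t) = {e}"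
proof -
  let ?P = "\<lambda>s. s \<in> interval V E x y \<and> (e \<in> f s \<longleftrightarrow> e \<in> f x)"
  have "?P x" using interval_ends[OF assms(1,2)] by simp
  then obtain s where s: "?P s" and min: "\<And>s'. ?P s' \<Longrightarrow> gdist V E s y \<le> gdist V E s' y"
    using ex_has_least_nat[of ?P x "\<lambda>s. gdist V E s y"] by blast
  have sV: "s \<in> V" using s interval_iff[OF assms(1,2)] by simp
  have "s \<noteq> y" using s assms(3) by blast
  then obtain t e' where t: "t \<in> interval V E s y" "sdiff (f s) (f t) = {e'}"
      "gdist V E t y < gdist V E s y"
    by (rule first_step[OF sV assms(2)])
  have tI: "t \<in> interval V E x y"
    using gconvexD[OF gconvex_interval[OF assms(1,2)] _ _ t(1)] s interval_ends[OF assms(1,2)] by blast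
  then have te: "e \<in> f t \<longleftrightarrow> e \<in> f y" using min[of t] t(3) assms(3) by auto
  then have "e \<in> sdiff (f s) (f t)" using s assms(3) unfolding sdiff_def by auto
  then have "sdiff (f s) (f t) = {e}" using t(2) by auto
  then show thesis using that s tI te by blast
qed

text \<open>Let \<open>a\<close> be a point of \<open>A\<close> nearest to \<open>x\<close> and
  \<open>e\<close> the coordinate flipped by a first step \<open>b\<close> towards \<open>x\<close>.
  A point \<open>a'\<close> of \<open>A\<close> agreeing with \<open>x\<close> at \<open>e\<close>
  would put \<open>b\<close> between \<open>a\<close> and \<open>a'\<close>, hence into
  \<open>A\<close>, yet nearer to \<open>x\<close>.\<close>

lemma separation:
  assumes A: "gconvex V E A" "A \<noteq> {}" and x: "x \<in> V" "x \<notin> A"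
  obtains e where "\<And>a. a \<in> A \<Longrightarrow> (e \<in> f a) \<noteq> (e \<in> f x)"
proof -
  have AV: "A \<subseteq> V" using A(1) unfolding gconvex_def by blast
  obtain a0 where "a0 \<in> A" using A(2) by blast
  then obtain a where a: "a \<in> A" and min: "\<And>a'. a' \<in> A \<Longrightarrow> gdist V E a x \<le> gdist V E a' x"
    using ex_has_least_nat[of "\<lambda>a. a \<in> A" a0 "\<lambda>a. gdist V E a x"] by blast
  have aV: "a \<in> V" and ax: "a \<noteq> x" using a AV x by auto
  obtain b e where b: "b \<in> interval V E a x" "sdiff (f a) (f b) = {e}"
      "gdist V E b x < gdist V E a x"
    by (rule first_step[OF aV x(1) ax])
  have bA: "b \<notin> A" using min[of b] b(3) by auto
  have box: "b \<in> V" "f a \<inter> f x \<subseteq> f b" "f b \<subseteq> f a \<union> f x" using b(1) interval_iff[OF aV x(1)] by auto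
  have e: "((e' \<in> f a) = (e' \<in> f b)) = (e' \<noteq> e)" for e' using b(2) unfolding sdiff_def by auto
  then have ex: "e \<in> f b \<longleftrightarrow> e \<in> f x" using box by blast
  have "(e \<in> f a') \<noteq> (e \<in> f x)" if a': "a' \<in> A" for a'
  proof
    assume "(e \<in> f a') = (e \<in> f x)"
    then have "f a \<inter> f a' \<subseteq> f b" "f b \<subseteq> f a \<union> f a'" using e ex by blast+
    then have "b \<in> interval V E a a'" using interval_iff[OF aV, of a'] box(1) a' AV by blast
    then show False using gconvexD[OF A(1) a a'] bA by blast
  qed
  then show thesis using that by blast
qed

text \<open>\<open>C\<close> is a copoint at \<open>x\<close> of the subgraph on \<open>Z\<close>,
  found by enlarging \<open>A\<close> maximally. A point outside the hull of \<open>C\<close> and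
  \<open>x\<close> is excluded by some convex \<open>D\<close>; one inside lies in an interval with
  ends in \<open>insert x C\<close>, and one end may be taken to be \<open>x\<close>.\<close>

lemma copoint_extension:
  assumes Z: "gconvex V E Z" "finite Z"
    and ph: "prehull_number_le Z (induced_adj E Z) 1"
    and A: "gconvex V E A" "A \<subseteq> Z" "A \<noteq> {}" and x: "x \<in> Z" "x \<notin> A"
  shows "\<exists>C. gconvex V E C \<and> A \<subseteq> C \<and> C \<subseteq> Z \<and> x \<notin> C \<and>
    (\<forall>y\<in>Z. (\<exists>D. gconvex V E D \<and> D \<subseteq> Z \<and> A \<subseteq> D \<and> x \<in> D \<and> y \<notin> D)
        \<or> (\<exists>k\<in>C. y \<in> interval V E x k))"
proof -
  let ?E = "induced_adj E Z"
  let ?F = "{C. gconvex V E C \<and> C \<subseteq> Z \<and> x \<notin> C}"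
  have ZV: "Z \<subseteq> V" using Z(1) unfolding gconvex_def by blast
  have "finite ?F" using Z(2) by (auto intro: finite_subset[of _ "Pow Z"])
  moreover have "A \<in> ?F" using A x by simp
  ultimately obtain C where C: "C \<in> ?F" "A \<subseteq> C" and max: "\<forall>D\<in>?F. C \<subseteq> D \<longrightarrow> C = D"
    using finite_has_maximal2[of ?F A] by auto
  have "copoint Z ?E x C"
    unfolding copoint_def gconvex_induced[OF conn Z(1)] using C max x(1) by auto
  moreover obtain m where m: "m \<le> 1" "prehull_prop Z ?E m"
    using ph unfolding prehull_number_le_def by auto
  ultimately have hull: "convex_hull_g Z ?E (insert x C) = interval_iter Z ?E m (insert x C)"
    unfolding prehull_prop_def by auto
  have CZ: "C \<subseteq> Z" "gconvex V E C" using C(1) by auto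
  have claim: "(\<exists>D. gconvex V E D \<and> D \<subseteq> Z \<and> A \<subseteq> D \<and> x \<in> D \<and> y \<notin> D)
        \<or> (\<exists>k\<in>C. y \<in> interval V E x k)" if y: "y \<in> Z" for y
  proof (cases "y \<in> convex_hull_g Z ?E (insert x C)")
    case False
    then obtain D where "gconvex Z ?E D" "insert x C \<subseteq> D" "y \<notin> D"
      unfolding convex_hull_g_def by auto
    then show ?thesis using C(2) gconvex_induced[OF conn Z(1)] by blast
  next
    case True
    obtain a where a: "a \<in> C" using A(3) C(2) by auto
    have in_interval: "u \<in> V" if "u \<in> insert x C" for u using that CZ(1) ZV x(1) by auto
    \<comment> \<open>\<open>m\<close> may be 0, when the hull is \<open>insert x C\<close> itself;
      then \<open>y\<close> serves as both ends.\<close>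
    have "y \<in> insert x C \<or> y \<in> interval_op Z ?E (insert x C)"
      using True hull m(1) unfolding interval_iter_def by (cases m) auto
    then obtain u v where uv: "u \<in> insert x C" "v \<in> insert x C" "y \<in> interval V E u v"
    proof
      assume "y \<in> insert x C"
      then show thesis using that[of y y] interval_ends[of y y] in_interval by auto
    next
      assume "y \<in> interval_op Z ?E (insert x C)"
      then obtain u v where "u \<in> insert x C" "v \<in> insert x C" "y \<in> interval Z ?E u v"
        unfolding interval_op_def by auto
      then show thesis using that[of u v] interval_induced[OF conn Z(1)] CZ(1) x(1) by auto
    qed
    note V = in_interval[OF uv(1)] in_interval[OF uv(2)] in_interval[OF insertI2[OF a]]
    consider "u \<in> C" "v \<in> C" | "u = x" "v \<in> C" | "v = x" "u \<in> C" | "u = x" "v = x" using uv by auto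
    then have "\<exists>k\<in>C. y \<in> interval V E x k"
    proof cases
      case 1
      then have "y \<in> C" using gconvexD[OF CZ(2) _ _ uv(3)] by simp
      then show ?thesis using interval_ends[of x y] in_interval by auto
    next
      case 4
      then have "y = x" using uv(3) interval_iff[OF V(1,2)] f_inj[of y x] V by auto
      then show ?thesis using interval_ends[of x a] V a in_interval by auto
    qed (use uv interval_commute[OF V(1,2)] in auto)
    then show ?thesis ..
  qed
  show ?thesis using CZ C claim by (intro exI[of _ C]) simp
qed

text \<open>\<open>W\<close> is adjoined so that the pre-hull condition applies with
  \<open>Q = W\<close>, and the empty set so that complements stay in the family.\<close>

definition halves :: "'a set \<Rightarrow> 'a set set" where
  "halves W = {W, {}} \<union> range (\<lambda>e. {v \<in> W. e \<in> f v}) \<union> range (\<lambda>e. {v \<in> W. e \<notin> f v})"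

lemma halves_cases:
  assumes "H \<in> halves W"
  obtains "H = W" | "H = {}" | e b where "H = {v \<in> W. (e \<in> f v) = b}"
  using assms unfolding halves_def by auto

lemma halves_side: "{v \<in> W. (e \<in> f v) = b} \<in> halves W"
  unfolding halves_def by (cases b) auto

lemma halves_subset: "H \<in> halves W \<Longrightarrow> H \<subseteq> W"
  by (erule halves_cases) auto

lemma halves_gconvex:
  assumes W: "gconvex V E W" and H: "H \<in> halves W"
  shows "gconvex V E H"
  using H
proof (cases rule: halves_cases)
  case (3 e b)
  have WV: "W \<subseteq> V" using W unfolding gconvex_def by simp
  show ?thesis unfolding gconvex_def
  proof (intro conjI ballI subsetI)
    show "z \<in> V" if "z \<in> H" for z using that WV 3 by auto
  next
    fix x y z assume xy: "x \<in> H" "y \<in> H" and z: "z \<in> interval V E x y"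
    then have "x \<in> W" "y \<in> W" using 3 by auto
    then have "z \<in> W" "f x \<inter> f y \<subseteq> f z" "f z \<subseteq> f x \<union> f y"
      using gconvexD[OF W _ _ z] interval_iff[of x y] WV z by auto
    then show "z \<in> H" using xy 3 by auto
  qed
qed (use W in \<open>auto simp: gconvex_def\<close>)

lemma halves_separation:
  assumes W: "gconvex V E W" and A: "gconvex V E A" "A \<subseteq> W" and x: "x \<in> W" "x \<notin> A"
  obtains H where "H \<in> halves W" "A \<subseteq> H" "x \<notin> H"
proof (cases "A = {}")
  case True
  then show thesis using that[of "{}"] unfolding halves_def by auto
next
  case False
  have "x \<in> V" using W x(1) unfolding gconvex_def by auto
  then obtain e where e: "\<And>a. a \<in> A \<Longrightarrow> (e \<in> f a) \<noteq> (e \<in> f x)"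
    using separation[OF A(1) False _ x(2)] by blast
  have "A \<subseteq> {v \<in> W. (e \<in> f v) = (e \<notin> f x)}" using e A(2) by auto
  then show thesis using that[OF halves_side] by simp
qed

lemma btw_halves:
  assumes W: "gconvex V E W" and y: "y \<in> interval V E x z"
  shows "btw (halves W) x y z"
  unfolding btw_def using gconvexD[OF halves_gconvex[OF W] _ _ y] by simp

lemma halfspaces_halves:
  assumes W: "gconvex V E W" "finite W"
    and ph: "\<And>Z. finite Z \<Longrightarrow> gconvex V E Z \<Longrightarrow> prehull_number_le Z (induced_adj E Z) 1"
  shows "halfspaces W (halves W)"
proof
  have WV: "W \<subseteq> V" using W(1) unfolding gconvex_def by simp
  show "finite W" by fact
  show "W \<in> halves W" unfolding halves_def by simp
  show "H \<subseteq> W" if "H \<in> halves W" for H using halves_subset[OF that] .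
  show "W - H \<in> halves W" if "H \<in> halves W" for H
    using that
  proof (cases rule: halves_cases)
    case (3 e b)
    then have "W - H = {v \<in> W. (e \<in> f v) = (\<not> b)}" by auto
    then show ?thesis using halves_side by simp
  qed (auto simp: halves_def)
  show "\<exists>s\<in>W - H. \<exists>t\<in>H. btw (halves W) x s y \<and> btw (halves W) x t y
       \<and> (\<forall>L\<in>halves W. L \<noteq> H \<and> L \<noteq> W - H \<longrightarrow> (s \<in> L \<longleftrightarrow> t \<in> L))"
    if H: "H \<in> halves W" and x: "x \<in> W - H" and y: "y \<in> H" for H x y
    using H
  proof (cases rule: halves_cases)
    case (3 e b)
    have V: "x \<in> V" "y \<in> V" "x \<in> W" "y \<in> W" and e: "(e \<in> f x) \<noteq> (e \<in> f y)"
      using x y 3 WV by auto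
    obtain s t where st: "s \<in> interval V E x y" "t \<in> interval V E x y"
      "e \<in> f s \<longleftrightarrow> e \<in> f x" "e \<in> f t \<longleftrightarrow> e \<in> f y" "sdiff (f s) (f t) = {e}"
      by (rule crossing_edge[OF V(1,2) e])
    have stW: "s \<in> W" "t \<in> W" using gconvexD[OF W(1) V(3,4)] st(1,2) by auto
    have sH: "s \<in> W - H" "t \<in> H" using st(3,4) stW x y 3 by auto
    have "s \<in> L \<longleftrightarrow> t \<in> L" if L: "L \<in> halves W" "L \<noteq> H" "L \<noteq> W - H" for L
      using L(1)
    proof (cases rule: halves_cases)
      case L3: (3 e' b')
      \<comment> \<open>Several coordinates may cut \<open>W\<close> alike; it is the sets,
        \<open>L\<close> against \<open>H\<close> and its complement, whose difference excludes the
        coordinate \<open>e\<close>.\<close>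
      have "e' \<noteq> e"
      proof
        assume "e' = e"
        then have "L = H \<or> L = W - H" using L3 3 by auto
        then show False using L(2,3) by simp
      qed
      then have "e' \<in> f s \<longleftrightarrow> e' \<in> f t" using st(5) unfolding sdiff_def by auto
      then show ?thesis using L3 stW by simp
    qed (use stW in auto)
    then show ?thesis using btw_halves[OF W(1) st(1)] btw_halves[OF W(1) st(2)]
      by (intro bexI[OF _ sH(1)] bexI[OF _ sH(2)]) simp
  qed (use x y in auto)
  show "\<exists>H\<in>halves W. P \<inter> Q \<subseteq> H \<and> x \<notin> H \<and>
         (\<forall>y\<in>Q. (\<exists>L\<in>halves W. P \<inter> Q \<subseteq> L \<and> x \<in> L \<and> y \<notin> L) \<or> (\<exists>k\<in>Q \<inter> H. btw (halves W) x y k))"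
    if Q: "Q \<in> halves W" and P: "P \<in> halves W" and ne: "P \<inter> Q \<noteq> {}" and x: "x \<in> Q - P" for Q P x
  proof -
    have QW: "Q \<subseteq> W" "finite Q" "gconvex V E Q"
      using halves_subset[OF Q] finite_subset[OF _ W(2)] halves_gconvex[OF W(1) Q] by simp_all
    have PQ: "gconvex V E (P \<inter> Q)" "P \<inter> Q \<subseteq> Q" and xQ: "x \<in> Q" "x \<notin> P \<inter> Q"
      using gconvex_Int[OF halves_gconvex[OF W(1) P] QW(3)] x by simp_all
    obtain C where C: "gconvex V E C" "P \<inter> Q \<subseteq> C" "C \<subseteq> Q" "x \<notin> C"
      and ext: "\<forall>y\<in>Q. (\<exists>D. gconvex V E D \<and> D \<subseteq> Q \<and> P \<inter> Q \<subseteq> D \<and> x \<in> D \<and> y \<notin> D)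
        \<or> (\<exists>k\<in>C. y \<in> interval V E x k)"
      using copoint_extension[OF QW(3,2) ph[OF QW(2,3)] PQ ne xQ] by (elim exE conjE) (rule that)
    have "C \<subseteq> W" "x \<in> W" using C(3) QW(1) xQ by auto
    \<comment> \<open>The copoint \<open>C\<close>, and below each convex \<open>D\<close> excluding
      a point \<open>y\<close>, are enlarged to halfspaces of \<open>W\<close>; either alternative
      of the pre-hull condition survives this.\<close>
    then obtain H where H: "H \<in> halves W" "C \<subseteq> H" "x \<notin> H"
      by (rule halves_separation[OF W(1) C(1) _ _ C(4)])
    have "(\<exists>L\<in>halves W. P \<inter> Q \<subseteq> L \<and> x \<in> L \<and> y \<notin> L) \<or> (\<exists>k\<in>Q \<inter> H. btw (halves W) x y k)"
      if y: "y \<in> Q" for y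
      using bspec[OF ext y]
    proof
      assume "\<exists>D. gconvex V E D \<and> D \<subseteq> Q \<and> P \<inter> Q \<subseteq> D \<and> x \<in> D \<and> y \<notin> D"
      then obtain D where D: "gconvex V E D" "D \<subseteq> Q" "P \<inter> Q \<subseteq> D" "x \<in> D" "y \<notin> D" by auto
      have "D \<subseteq> W" "y \<in> W" using D(2) QW(1) y by auto
      then obtain L where L: "L \<in> halves W" "D \<subseteq> L" "y \<notin> L"
        by (rule halves_separation[OF W(1) D(1) _ _ D(5)])
      then have "\<exists>L\<in>halves W. P \<inter> Q \<subseteq> L \<and> x \<in> L \<and> y \<notin> L"
        using order_trans[OF D(3) L(2)] subsetD[OF L(2) D(4)] by (intro bexI[OF _ L(1)]) simp
      then show ?thesis ..
    next
      assume "\<exists>k\<in>C. y \<in> interval V E x k"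
      then obtain k where "k \<in> C" "y \<in> interval V E x k" by auto
      then have "\<exists>k\<in>Q \<inter> H. btw (halves W) x y k"
        using C(3) H(2) btw_halves[OF W(1)] by (intro bexI[of _ k]) auto
      then show ?thesis ..
    qed
    then show ?thesis using H(3) order_trans[OF C(2) H(2)] by (intro bexI[OF _ H(1)]) simp
  qed
qed

text \<open>\<open>H\<close> leaves out a point of \<open>B \<inter> C \<inter> D\<close>, so it is
  smaller than \<open>W\<close> and \<open>A, B, C, D\<close> fail \<open>quad\<close> in it. The
  only condition that can fail is that \<open>B \<inter> C \<inter> D\<close> meets
  \<open>H\<close>, which is what allows \<open>H\<close> to replace \<open>A\<close>.\<close>

lemma replace_by_half:
  assumes W: "gconvex V E W" "finite W"
    and min: "\<And>W' A B C D. \<lbrakk>gconvex V E W'; finite W'; card W' < card W; gconvex V E A; gconvex V E B;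
       gconvex V E C; gconvex V E D\<rbrakk> \<Longrightarrow> \<not> quad W' A B C D"
    and gc: "gconvex V E A" "gconvex V E B" "gconvex V E C" "gconvex V E D"
    and q: "quad W A B C D"
  obtains H where "H \<in> halves W" "quad W H B C D"
proof -
  obtain p where p: "p \<in> W" "p \<in> B" "p \<in> C" "p \<in> D" using q unfolding quad_def by auto
  then have "p \<notin> W \<inter> A" using q unfolding quad_def by auto
  then obtain H where H: "H \<in> halves W" "W \<inter> A \<subseteq> H" "p \<notin> H"
    using halves_separation[OF W(1) gconvex_Int[OF W(1) gc(1)] _ p(1)] by auto
  have HW: "H \<subseteq> W" using halves_subset[OF H(1)] .
  then have "H \<subset> W" using H(3) p(1) by auto
  then have "finite H" "card H < card W"
    using finite_subset[OF HW W(2)] psubset_card_mono[OF W(2)] by simp_all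
  then have nq: "\<not> quad H A B C D" using min[OF halves_gconvex[OF W(1) H(1)]] gc by blast
  have sub: "W \<inter> A \<inter> B \<inter> C \<subseteq> H \<inter> A \<inter> B \<inter> C" "W \<inter> A \<inter> B \<inter> D \<subseteq> H \<inter> A \<inter> B \<inter> D"
    "W \<inter> A \<inter> C \<inter> D \<subseteq> H \<inter> A \<inter> C \<inter> D" "H \<inter> A \<inter> B \<inter> C \<inter> D \<subseteq> W \<inter> A \<inter> B \<inter> C \<inter> D" using H(2) HW by auto
  then have "H \<inter> B \<inter> C \<inter> D = {}" using nq q unfolding quad_def by auto
  moreover have "W \<inter> H = H" using HW by auto
  ultimately have "quad W H B C D" using sub q unfolding quad_def by auto
  then show thesis using that[OF H(1)] by blast
qed

text \<open>Induction on the size of \<open>W\<close> provides the minimality required by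
  \<open>replace_by_half\<close> and \<open>min_halfspaces\<close>; rotations bring each set in turn
  into the position that gets replaced.\<close>

lemma no_convex_quad:
  assumes ph: "\<And>Z. finite Z \<Longrightarrow> gconvex V E Z \<Longrightarrow> prehull_number_le Z (induced_adj E Z) 1"
    and W: "gconvex V E W" "finite W"
    and gc: "gconvex V E A" "gconvex V E B" "gconvex V E C" "gconvex V E D"
  shows "\<not> quad W A B C D"
  using W gc
proof (induction "card W" arbitrary: W A B C D rule: less_induct)
  case less
  note W = less.prems(1,2) and gc = less.prems(3-6)
  have min: "\<not> quad W' A B C D"
    if "gconvex V E W'" "finite W'" "card W' < card W" "gconvex V E A" "gconvex V E B"
       "gconvex V E C" "gconvex V E D" for W' A B C D
    using less.hyps[OF that(3,1,2,4-7)] .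
  note replace = replace_by_half[OF W min]
  interpret halfspaces W "halves W" using halfspaces_halves[OF W ph] .
  interpret min_halfspaces W "halves W"
  proof
    fix Z A B C D assume Z: "Z \<in> halves W" "Z \<noteq> W"
      and *: "A \<in> halves W" "B \<in> halves W" "C \<in> halves W" "D \<in> halves W"
    have "Z \<subset> W" using Z(2) halves_subset[OF Z(1)] by auto
    then have "finite Z" "card Z < card W"
      using finite_subset[OF _ W(2)] psubset_card_mono[OF W(2)] by auto
    then show "\<not> quad Z A B C D" using min halves_gconvex[OF W(1)] Z(1) * by blast
  qed
  show ?case
  proof
    assume "quad W A B C D"
    then obtain A' where A': "A' \<in> halves W" "quad W A' B C D" using replace[OF _ _ _ _ _ _ _ gc] by blast
    note gA = halves_gconvex[OF W(1) A'(1)]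
    obtain B' where B': "B' \<in> halves W" "quad W B' C D A'"
      using replace[OF _ _ _ _ _ _ _ gc(2-4) gA quad_rotate[OF A'(2)]] by blast
    note gB = halves_gconvex[OF W(1) B'(1)]
    obtain C' where C': "C' \<in> halves W" "quad W C' D A' B'"
      using replace[OF _ _ _ _ _ _ _ gc(3,4) gA gB quad_rotate[OF B'(2)]] by blast
    note gC = halves_gconvex[OF W(1) C'(1)]
    obtain D' where D': "D' \<in> halves W" "quad W D' A' B' C'"
      using replace[OF _ _ _ _ _ _ _ gc(4) gA gB gC quad_rotate[OF C'(2)]] by blast
    have "Quad D' A' B' C'" using A'(1) B'(1) C'(1) D' unfolding Quad_def by simp
    then show False using no_Quad by simp
  qed
qed

lemma four_convex_sets:
  assumes ph: "\<And>Z. finite Z \<Longrightarrow> gconvex V E Z \<Longrightarrow> prehull_number_le Z (induced_adj E Z) 1"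
    and gc: "gconvex V E A" "gconvex V E B" "gconvex V E C" "gconvex V E D"
    and ne: "A \<inter> B \<inter> C \<noteq> {}" "A \<inter> B \<inter> D \<noteq> {}" "A \<inter> C \<inter> D \<noteq> {}" "B \<inter> C \<inter> D \<noteq> {}"
  shows "A \<inter> B \<inter> C \<inter> D \<noteq> {}"
proof
  assume empty: "A \<inter> B \<inter> C \<inter> D = {}"
  obtain p q r s where pts: "p \<in> A \<inter> B \<inter> C" "q \<in> A \<inter> B \<inter> D" "r \<in> A \<inter> C \<inter> D" "s \<in> B \<inter> C \<inter> D"
    using ne by auto
  have ptsV: "p \<in> V" "q \<in> V" "r \<in> V" "s \<in> V" using pts gc unfolding gconvex_def by auto
  \<comment> \<open>\<open>W\<close> is the trace of a finite subcube containing the four witnesses: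
    finite as \<open>f\<close> is injective, convex as intermediate vertices use only coordinates of
    the ends.\<close>
  define U where "U = f p \<union> f q \<union> f r \<union> f s"
  define W where "W = {v \<in> V. f v \<subseteq> U}"
  have "finite U" using fin ptsV unfolding U_def by simp
  moreover have "inj_on f W" using f_inj unfolding inj_on_def W_def by blast
  moreover have "f ` W \<subseteq> Pow U" unfolding W_def by auto
  ultimately have "finite W" using inj_on_finite[of f W "Pow U"] by simp
  moreover have "gconvex V E W" unfolding gconvex_def
  proof (intro conjI ballI subsetI)
    show "z \<in> V" if "z \<in> W" for z using that unfolding W_def by simp
    show "z \<in> W" if "x \<in> W" "y \<in> W" "z \<in> interval V E x y" for x y z
      using that interval_iff[of x y z] unfolding W_def by auto
  qed
  ultimately have "\<not> quad W A B C D" using no_convex_quad[OF ph] gc by simp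
  moreover have "p \<in> W" "q \<in> W" "r \<in> W" "s \<in> W" using ptsV unfolding W_def U_def by auto
  ultimately show False using pts empty unfolding quad_def by auto
qed

end

section \<open>Helly families and medians\<close>

lemma helly_propI:
  assumes step: "\<And>S. \<lbrakk>finite S; \<And>A. A \<in> S \<Longrightarrow> gconvex V E A; card S = Suc h;
      \<And>T. T \<subseteq> S \<Longrightarrow> card T \<le> h \<Longrightarrow> \<Inter>T \<noteq> {}\<rbrakk> \<Longrightarrow> \<Inter>S \<noteq> {}"
  shows "helly_prop V E h"
proof -
  have "\<Inter>F \<noteq> {}"
    if "finite F" "\<forall>A\<in>F. gconvex V E A" "\<forall>T\<subseteq>F. card T \<le> h \<longrightarrow> \<Inter>T \<noteq> {}" for F
    using that
  proof (induction "card F" arbitrary: F rule: less_induct)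
    case less
    have small: "\<Inter>S \<noteq> {}" if S: "S \<subseteq> F" "card S \<le> Suc h" for S
    proof (cases "card S \<le> h")
      case True
      then show ?thesis using less.prems(3) S(1) by simp
    next
      case False
      then have "card S = Suc h" using S(2) by simp
      moreover have "finite S" using finite_subset[OF S(1) less.prems(1)] .
      moreover have "\<Inter>T \<noteq> {}" if "T \<subseteq> S" "card T \<le> h" for T
        using less.prems(3) order_trans[OF that(1) S(1)] that(2) by simp
      moreover have "gconvex V E A" if "A \<in> S" for A using less.prems(2) S(1) that by auto
      ultimately show ?thesis using step[of S] by simp
    qed
    show ?case
    proof (cases "card F \<le> Suc h")
      case True
      then show ?thesis using small by simp
    next
      case False
      then obtain A where A: "A \<in> F" by fastforce
      define F0 where "F0 = F - {A}"
      have F0: "finite F0" "F = insert A F0" "A \<notin> F0" using A less.prems(1) unfolding F0_def by auto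
      then have card: "card F = Suc (card F0)" by simp
      \<comment> \<open>Traces on a fixed member \<open>A\<close> form a smaller family. Any
        \<open>h\<close> of them meet, because together with \<open>A\<close> they involve at most
        \<open>h + 1\<close> members of \<open>F\<close>, which \<open>small\<close> covers.\<close>
      let ?F = "(\<inter>) A ` F0"
      have "card ?F < card F" using card card_image_le[OF F0(1), of "(\<inter>) A"] by simp
      moreover have "\<forall>B\<in>?F. gconvex V E B" using less.prems(2) F0(2) by (auto intro: gconvex_Int)
      moreover have "\<forall>T\<subseteq>?F. card T \<le> h \<longrightarrow> \<Inter>T \<noteq> {}"
      proof (intro allI impI)
        fix T assume T: "T \<subseteq> ?F" "card T \<le> h"
        \<comment> \<open>Distinct members may have equal traces on \<open>A\<close>; an injective
          choice of preimages keeps their number at most \<open>h\<close>.\<close>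
        then obtain S where S: "S \<subseteq> F0" "inj_on ((\<inter>) A) S" "T = (\<inter>) A ` S"
          using subset_image_inj[of T "(\<inter>) A" F0] by auto
        have "card S \<le> h" using T(2) S(3) card_image[OF S(2)] by simp
        moreover have "finite S" using finite_subset[OF S(1) F0(1)] .
        ultimately have "card (insert A S) \<le> Suc h" by (simp add: card_insert_if)
        then have "\<Inter>(insert A S) \<noteq> {}" using small[of "insert A S"] S(1) F0(2) by auto
        moreover have "\<Inter>(insert A S) \<subseteq> \<Inter>T" using S(3) by auto
        ultimately show "\<Inter>T \<noteq> {}" by auto
      qed
      ultimately have "\<Inter>?F \<noteq> {}" using less.hyps[of ?F] F0(1) by simp
      moreover have "F0 \<noteq> {}" using card False by auto
      then have "\<Inter>?F = \<Inter>F" using F0(2) by auto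
      ultimately show ?thesis by simp
    qed
  qed
  then show ?thesis unfolding helly_prop_def by auto
qed

lemma helly_prop_mono: "helly_prop V E h \<Longrightarrow> h \<le> k \<Longrightarrow> helly_prop V E k"
  unfolding helly_prop_def by (meson le_trans)

text \<open>Given three sets and a common point of each pair, every set contains two of these
  points, hence their interval and with it the median.\<close>

lemma median_imp_helly_prop_2:
  assumes "median_graph V E"
  shows "helly_prop V E 2"
proof (rule helly_propI)
  fix S assume S: "\<And>A. A \<in> S \<Longrightarrow> gconvex V E A" "card S = Suc 2"
    and sub: "\<And>T. T \<subseteq> S \<Longrightarrow> card T \<le> 2 \<Longrightarrow> \<Inter>T \<noteq> {}"
  then have "card S = 3" by simp
  then obtain A B C where S3: "S = {A, B, C}" by (auto simp: card_3_iff)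
  have "A \<inter> B \<noteq> {}" "B \<inter> C \<noteq> {}" "C \<inter> A \<noteq> {}"
    using sub[of "{A, B}"] sub[of "{B, C}"] sub[of "{C, A}"] S3 by (simp_all add: card_insert_if)
  then obtain u v w where uvw: "u \<in> A" "u \<in> B" "v \<in> B" "v \<in> C" "w \<in> C" "w \<in> A" by auto
  have gc: "gconvex V E A" "gconvex V E B" "gconvex V E C" using S(1) S3 by auto
  then have "u \<in> V" "v \<in> V" "w \<in> V" using uvw unfolding gconvex_def by auto
  then obtain m where m: "m \<in> interval V E u v" "m \<in> interval V E v w" "m \<in> interval V E w u"
    using assms unfolding median_graph_def by blast
  have "m \<in> B" "m \<in> C" "m \<in> A"
    using gconvexD[OF gc(2) uvw(2,3) m(1)] gconvexD[OF gc(3) uvw(4,5) m(2)]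
      gconvexD[OF gc(1) uvw(6,1) m(3)] by simp_all
  then show "\<Inter>S \<noteq> {}" unfolding S3 by auto
qed

context isometric_embedding
begin

lemma helly_prop_2_imp_median:
  assumes h: "helly_prop V E 2"
  shows "median_graph V E"
  unfolding median_graph_def
proof (intro conjI ballI)
  show "connected_graph V E" by (rule conn)
  fix u v w assume V: "u \<in> V" "v \<in> V" "w \<in> V"
  let ?X = "interval V E u v" and ?Y = "interval V E v w" and ?Z = "interval V E w u"
  have ends: "v \<in> ?X" "v \<in> ?Y" "w \<in> ?Y" "w \<in> ?Z" "u \<in> ?Z" "u \<in> ?X"
    using interval_ends V by auto
  have helly: "\<Inter>F \<noteq> {}"
    if "finite F" "\<And>A. A \<in> F \<Longrightarrow> gconvex V E A" "\<And>S. S \<subseteq> F \<Longrightarrow> card S \<le> 2 \<Longrightarrow> \<Inter>S \<noteq> {}" for F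
    using h that unfolding helly_prop_def by auto
  have "\<Inter>{?X, ?Y, ?Z} \<noteq> {}"
  proof (rule helly)
    show "finite {?X, ?Y, ?Z}" by simp
    show "gconvex V E A" if "A \<in> {?X, ?Y, ?Z}" for A using that gconvex_interval V by auto
    fix S assume S: "S \<subseteq> {?X, ?Y, ?Z}" "card S \<le> 2"
    \<comment> \<open>The intervals may coincide, so the count is used only to confine
      \<open>S\<close> to two of them, which share one of \<open>v\<close>, \<open>w\<close>,
      \<open>u\<close>.\<close>
    have "S \<subseteq> {?X, ?Y} \<or> S \<subseteq> {?Y, ?Z} \<or> S \<subseteq> {?Z, ?X}"
    proof (rule ccontr)
      assume "\<not> ?thesis"
      then have "?X \<noteq> ?Y" "?Y \<noteq> ?Z" "?X \<noteq> ?Z" "S = {?X, ?Y, ?Z}" using S(1) by auto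
      then show False using S(2) by simp
    qed
    then have "v \<in> \<Inter>S \<or> w \<in> \<Inter>S \<or> u \<in> \<Inter>S" using ends by auto
    then show "\<Inter>S \<noteq> {}" by auto
  qed
  then obtain m where m: "m \<in> ?X \<inter> ?Y \<inter> ?Z" by auto
  \<comment> \<open>Lying in all three intervals forces every coordinate by majority vote;
    injectivity of \<open>f\<close> then gives uniqueness.\<close>
  have maj: "f k = (f u \<inter> f v) \<union> (f v \<inter> f w) \<union> (f w \<inter> f u)" if "k \<in> ?X \<inter> ?Y \<inter> ?Z" for k
    using that V interval_iff by auto
  have "k = m" if "k \<in> ?X \<inter> ?Y \<inter> ?Z" for k
    using maj[OF that] maj[OF m] that m f_inj[of k m] interval_iff V by auto
  then show "\<exists>!m. m \<in> ?X \<inter> ?Y \<inter> ?Z" using m by blast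
qed

lemma helly_prop_3:
  assumes ph: "\<And>Z. finite Z \<Longrightarrow> gconvex V E Z \<Longrightarrow> prehull_number_le Z (induced_adj E Z) 1"
  shows "helly_prop V E 3"
proof (rule helly_propI)
  fix S assume S: "\<And>A. A \<in> S \<Longrightarrow> gconvex V E A" "card S = Suc 3"
    and sub: "\<And>T. T \<subseteq> S \<Longrightarrow> card T \<le> 3 \<Longrightarrow> \<Inter>T \<noteq> {}"
  obtain D S' where DS: "S = insert D S'" "card S' = 3" using S(2) by (metis card_Suc_eq)
  then obtain A B C where S4: "S = {A, B, C, D}" by (auto simp: card_3_iff)
  have "A \<inter> B \<inter> C \<noteq> {}" "A \<inter> B \<inter> D \<noteq> {}" "A \<inter> C \<inter> D \<noteq> {}" "B \<inter> C \<inter> D \<noteq> {}"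
    using sub[of "{A, B, C}"] sub[of "{A, B, D}"] sub[of "{A, C, D}"] sub[of "{B, C, D}"] S4
    by (simp_all add: card_insert_if Int_assoc)
  then have "A \<inter> B \<inter> C \<inter> D \<noteq> {}"
    using four_convex_sets[OF ph S(1) S(1) S(1) S(1), of A B C D] S4 by simp
  then show "\<Inter>S \<noteq> {}" unfolding S4 by auto
qed

end

theorem theorem8p2:
  fixes V :: "'a set" and E :: "'a \<Rightarrow> 'a \<Rightarrow> bool"
  assumes "peano_partial_cube V E"
  shows "(\<exists>h. helly_prop V E h) \<and> helly_number V E \<le> 3 \<and>
         (helly_number V E = 3 \<longleftrightarrow> \<not> median_graph V E)"
proof -
  have pc: "partial_cube V E"
    and ph: "\<And>Z. finite Z \<Longrightarrow> gconvex V E Z \<Longrightarrow> prehull_number_le Z (induced_adj E Z) 1"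
    using assms unfolding peano_partial_cube_def by auto
  from pc obtain f :: "'a \<Rightarrow> ('a \<times> 'a) set" where f: "\<forall>v\<in>V. finite (f v)"
      "\<forall>u\<in>V. \<forall>v\<in>V. gdist V E u v = card ((f u - f v) \<union> (f v - f u))"
    unfolding partial_cube_def by auto
  interpret isometric_embedding V E f
    using pc f unfolding partial_cube_def by unfold_locales (auto simp: sdiff_def)
  have h3: "helly_prop V E 3" using helly_prop_3[OF ph] .
  then have le: "helly_number V E \<le> 3" unfolding helly_number_def by (rule Least_le)
  have least: "helly_prop V E (helly_number V E)" unfolding helly_number_def using h3 by (rule LeastI)
  \<comment> \<open>The least value is attained, since 3 is admissible, and admissibility passes to
    larger numbers; so the Helly number drops below 3 exactly when 2 is admissible.\<close>
  have "helly_number V E \<le> 2 \<longleftrightarrow> helly_prop V E 2"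
    using helly_prop_mono[OF least] Least_le[of "helly_prop V E" 2] unfolding helly_number_def by auto
  also have "\<dots> \<longleftrightarrow> median_graph V E"
    using helly_prop_2_imp_median median_imp_helly_prop_2 by auto
  finally have "helly_number V E = 3 \<longleftrightarrow> \<not> median_graph V E" using le by auto
  then show ?thesis using h3 le by auto
qed

end
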